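(* Let $N\ge0$ be an integer and let $a,b,d,e,\mu$ be complex numbers. For $x=u(u+\mu)$, $u\in\mathbb C$, put $$U_n(x)={}_9F_8\left[{a,\,1+\frac a2,\,b-u,\,b+u+\mu,\,d,\,e,\,a+N+1,\,2a+1-N-2b-d-e-\mu+n,\,-n\atop\frac a2,\,a-b+1+u,\,a-b-\mu+1-u,\,a-d+1,\,a-e+1,\,-N,\,2b+\mu+d+e-a+N-n,\,a+n+1};1\right],$$ and, with $a'=a-d-e-N+1$, $$V_m(x)={}_9F_8\left[{a',\,1+\frac{a'}2,\,b-u,\,b+\mu+u,\,-N-d+1,\,-N-e+1,\,a-d-e+2,\,2a+1-N-2b-d-e-\mu+m,\,-m\atop\frac{a'}2,\,a-b-d-e-N+2+u,\,a-\mu-b-d-e-N+2-u,\,a-e+1,\,a-d+1,\,-N,\,2b-a+\mu-m+1,\,a-d-e-N+2+m};1\right].$$ Then, for $0\le n,m\le N$, $$\sum_{k=0}^NU_n(x_k)V_m(x_k)\,r_k=C_n\,\delta_{n,m},$$ where $x_k=(b+k)(b+k+\mu)$, $$r_k=\frac{\bigl(\mu+2b,\,1+\frac12(\mu+2b),\,\mu+2b-a,\,a-d+1,\,a-e+1,\,-N,\,\mu+2b+d+e-a+N-1\bigr)_k}{\bigl(\frac12(\mu+2b),\,a+1,\,\mu+2b+d-a,\,\mu+2b+e-a,\,\mu+2b+N+1,\,a-d-e+2-N,\,1\bigr)_k}$$ $$\times\frac{(a+1,\,\mu+2b+d-a,\,\mu+2b+e-a,\,d+e-a-1)_N}{(\mu+2b+1,\,d,\,e,\,\mu+2b+d+e-2a-1)_N},$$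 and $$C_n=\frac{(1,\,a+1-N-\mu-2b-d,\,a+1-N-\mu-2b-e)_n}{(-N,\,a+1-N-\mu-2b-d-e,\,a-d+1)_n}\cdot\frac{(2a+2-\mu-2b-d-e,\,a+2-N-d-e,\,a+1)_n}{(a-e+1,\,a-\mu-2b,\,2a+2-N-\mu-2b-d-e)_n}.$$
   Context: Here $(x)_0=1$, $(x)_k=x(x+1)\cdots(x+k-1)$ is the ordinary shifted factorial, $(x_1,\dots,x_r)_k=\prod_i(x_i)_k$, $\delta_{n,m}$ is the Kronecker delta, and $${}_9F_8\left[{\alpha_1,\dots,\alpha_8,-n\atop\beta_1,\dots,\beta_8};1\right]=\sum_{k=0}^n\frac{(\alpha_1,\dots,\alpha_8,-n)_k}{(\beta_1,\dots,\beta_8,1)_k}.$$ $U_n,V_m$ are invariant under $u\mapsto-\mu-u$, hence are functions of $x$; at $x=x_k$ one may take $u=b+k$. The parameters are assumed to be such that no zero denominators occur.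
   Formalization: The printed C_n fails for n≥1: with N=n=m=1, (a,b,d,e,μ)=(2,0,−1,−1,1) the sum is −5/4 but C_1=−35/24. Here C_n is multiplied by (s+n)/(s+2n) for n≥1, where s=2a+1−N−2b−d−e−μ, and s+2n≠0 is assumed when n=m≥1. *)

theory Defs
  imports Complex_Main
begin

definition mpoch :: "complex list \<Rightarrow> nat \<Rightarrow> complex" where
  "mpoch xs k = (\<Prod>x\<leftarrow>xs. pochhammer x k)"

text \<open>The terminating series with upper parameters \<open>as, -n\<close> and lower parameters \<open>bs\<close>
  at argument 1; below, both lists always have length 8.\<close>
definition hyp_term :: "complex list \<Rightarrow> complex list \<Rightarrow> nat \<Rightarrow> complex" where
  "hyp_term as bs n = (\<Sum>k=0..n. mpoch (as @ [- of_nat n]) k / mpoch (bs @ [1]) k)"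

definition U_upper ::
  "nat \<Rightarrow> complex \<Rightarrow> complex \<Rightarrow> complex \<Rightarrow> complex \<Rightarrow> complex \<Rightarrow> nat \<Rightarrow> complex \<Rightarrow> complex list" where
  "U_upper N a b d e \<mu> n u =
    [a, 1 + a / 2, b - u, b + u + \<mu>, d, e, a + of_nat N + 1,
     2 * a + 1 - of_nat N - 2 * b - d - e - \<mu> + of_nat n]"

definition U_lower ::
  "nat \<Rightarrow> complex \<Rightarrow> complex \<Rightarrow> complex \<Rightarrow> complex \<Rightarrow> complex \<Rightarrow> nat \<Rightarrow> complex \<Rightarrow> complex list" where
  "U_lower N a b d e \<mu> n u =
    [a / 2, a - b + 1 + u, a - b - \<mu> + 1 - u, a - d + 1, a - e + 1, - of_nat N,
     2 * b + \<mu> + d + e - a + of_nat N - of_nat n, a + of_nat n + 1]"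

definition V_upper ::
  "nat \<Rightarrow> complex \<Rightarrow> complex \<Rightarrow> complex \<Rightarrow> complex \<Rightarrow> complex \<Rightarrow> nat \<Rightarrow> complex \<Rightarrow> complex list" where
  "V_upper N a b d e \<mu> m u = (let a' = a - d - e - of_nat N + 1 in
    [a', 1 + a' / 2, b - u, b + \<mu> + u, - of_nat N - d + 1, - of_nat N - e + 1, a - d - e + 2,
     2 * a + 1 - of_nat N - 2 * b - d - e - \<mu> + of_nat m])"

definition V_lower ::
  "nat \<Rightarrow> complex \<Rightarrow> complex \<Rightarrow> complex \<Rightarrow> complex \<Rightarrow> complex \<Rightarrow> nat \<Rightarrow> complex \<Rightarrow> complex list" where
  "V_lower N a b d e \<mu> m u = (let a' = a - d - e - of_nat N + 1 in
    [a' / 2, a - b - d - e - of_nat N + 2 + u, a - \<mu> - b - d - e - of_nat N + 2 - u,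
     a - e + 1, a - d + 1, - of_nat N, 2 * b - a + \<mu> - of_nat m + 1,
     a - d - e - of_nat N + 2 + of_nat m])"

definition U_par ::
  "nat \<Rightarrow> complex \<Rightarrow> complex \<Rightarrow> complex \<Rightarrow> complex \<Rightarrow> complex \<Rightarrow> nat \<Rightarrow> complex \<Rightarrow> complex" where
  "U_par N a b d e \<mu> n u = hyp_term (U_upper N a b d e \<mu> n u) (U_lower N a b d e \<mu> n u) n"

definition V_par ::
  "nat \<Rightarrow> complex \<Rightarrow> complex \<Rightarrow> complex \<Rightarrow> complex \<Rightarrow> complex \<Rightarrow> nat \<Rightarrow> complex \<Rightarrow> complex" where
  "V_par N a b d e \<mu> m u = hyp_term (V_upper N a b d e \<mu> m u) (V_lower N a b d e \<mu> m u) m"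

text \<open>\<open>U\<close> and \<open>V\<close> as functions of \<open>x = u(u + \<mu>)\<close>. The choice of \<open>u\<close> is immaterial, see the
  lemmas \<open>U_eq\<close> and \<open>V_eq\<close>.\<close>
definition U ::
  "nat \<Rightarrow> complex \<Rightarrow> complex \<Rightarrow> complex \<Rightarrow> complex \<Rightarrow> complex \<Rightarrow> nat \<Rightarrow> complex \<Rightarrow> complex" where
  "U N a b d e \<mu> n x = U_par N a b d e \<mu> n (SOME u. x = u * (u + \<mu>))"

definition V ::
  "nat \<Rightarrow> complex \<Rightarrow> complex \<Rightarrow> complex \<Rightarrow> complex \<Rightarrow> complex \<Rightarrow> nat \<Rightarrow> complex \<Rightarrow> complex" where
  "V N a b d e \<mu> m x = V_par N a b d e \<mu> m (SOME u. x = u * (u + \<mu>))"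

lemma U_par_invariant: "U_par N a b d e \<mu> n (- \<mu> - u) = U_par N a b d e \<mu> n u"
  unfolding U_par_def hyp_term_def
  by (intro sum.cong refl)
    (simp add: mpoch_def U_upper_def U_lower_def algebra_simps)

lemma V_par_invariant: "V_par N a b d e \<mu> m (- \<mu> - u) = V_par N a b d e \<mu> m u"
  unfolding V_par_def hyp_term_def
  by (intro sum.cong refl)
    (simp add: mpoch_def V_upper_def V_lower_def Let_def algebra_simps)

lemma same_x_cases:
  fixes u w \<mu> :: complex
  assumes "u * (u + \<mu>) = w * (w + \<mu>)"
  shows "w = u \<or> w = - \<mu> - u"
proof -
  have "(w - u) * (w + u + \<mu>) = 0"
    using assms by (simp add: algebra_simps)
  then have "w - u = 0 \<or> w + u + \<mu> = 0"
    by simp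
  then show ?thesis
  proof
    assume "w + u + \<mu> = 0"
    then have "w = - \<mu> - u"
      by (metis add.commute add.assoc add_diff_cancel_left' diff_0 diff_diff_eq)
    then show ?thesis ..
  qed simp
qed

lemma U_eq: "U N a b d e \<mu> n (u * (u + \<mu>)) = U_par N a b d e \<mu> n u"
proof -
  define w where "w = (SOME w. u * (u + \<mu>) = w * (w + \<mu>))"
  have "u * (u + \<mu>) = w * (w + \<mu>)"
    unfolding w_def by (rule someI) (rule refl)
  then have "U_par N a b d e \<mu> n w = U_par N a b d e \<mu> n u"
    using same_x_cases[of u \<mu> w] U_par_invariant[of N a b d e \<mu> n u] by metis
  then show ?thesis
    by (simp only: U_def w_def)
qed

lemma V_eq: "V N a b d e \<mu> m (u * (u + \<mu>)) = V_par N a b d e \<mu> m u"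
proof -
  define w where "w = (SOME w. u * (u + \<mu>) = w * (w + \<mu>))"
  have "u * (u + \<mu>) = w * (w + \<mu>)"
    unfolding w_def by (rule someI) (rule refl)
  then have "V_par N a b d e \<mu> m w = V_par N a b d e \<mu> m u"
    using same_x_cases[of u \<mu> w] V_par_invariant[of N a b d e \<mu> m u] by metis
  then show ?thesis
    by (simp only: V_def w_def)
qed

definition x_pt :: "complex \<Rightarrow> complex \<Rightarrow> nat \<Rightarrow> complex" where
  "x_pt b \<mu> k = (b + of_nat k) * (b + of_nat k + \<mu>)"

definition r_lower :: "nat \<Rightarrow> complex \<Rightarrow> complex \<Rightarrow> complex \<Rightarrow> complex \<Rightarrow> complex \<Rightarrow> complex list" where
  "r_lower N a b d e \<mu> =
    [(\<mu> + 2 * b) / 2, a + 1, \<mu> + 2 * b + d - a, \<mu> + 2 * b + e - a, \<mu> + 2 * b + of_nat N + 1,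
     a - d - e + 2 - of_nat N, 1]"

definition r_const_lower :: "complex \<Rightarrow> complex \<Rightarrow> complex \<Rightarrow> complex \<Rightarrow> complex \<Rightarrow> complex list" where
  "r_const_lower a b d e \<mu> = [\<mu> + 2 * b + 1, d, e, \<mu> + 2 * b + d + e - 2 * a - 1]"

definition r_weight ::
  "nat \<Rightarrow> complex \<Rightarrow> complex \<Rightarrow> complex \<Rightarrow> complex \<Rightarrow> complex \<Rightarrow> nat \<Rightarrow> complex" where
  "r_weight N a b d e \<mu> k =
    mpoch [\<mu> + 2 * b, 1 + (\<mu> + 2 * b) / 2, \<mu> + 2 * b - a, a - d + 1, a - e + 1, - of_nat N,
           \<mu> + 2 * b + d + e - a + of_nat N - 1] k
      / mpoch (r_lower N a b d e \<mu>) k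
    * (mpoch [a + 1, \<mu> + 2 * b + d - a, \<mu> + 2 * b + e - a, d + e - a - 1] N
      / mpoch (r_const_lower a b d e \<mu>) N)"

definition C_lower1 :: "nat \<Rightarrow> complex \<Rightarrow> complex \<Rightarrow> complex \<Rightarrow> complex \<Rightarrow> complex \<Rightarrow> complex list" where
  "C_lower1 N a b d e \<mu> =
    [- of_nat N, a + 1 - of_nat N - \<mu> - 2 * b - d - e, a - d + 1]"

definition C_lower2 :: "nat \<Rightarrow> complex \<Rightarrow> complex \<Rightarrow> complex \<Rightarrow> complex \<Rightarrow> complex \<Rightarrow> complex list" where
  "C_lower2 N a b d e \<mu> =
    [a - e + 1, a - \<mu> - 2 * b, 2 * a + 2 - of_nat N - \<mu> - 2 * b - d - e]"

definition C_printed ::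
  "nat \<Rightarrow> complex \<Rightarrow> complex \<Rightarrow> complex \<Rightarrow> complex \<Rightarrow> complex \<Rightarrow> nat \<Rightarrow> complex" where
  "C_printed N a b d e \<mu> n =
    mpoch [1, a + 1 - of_nat N - \<mu> - 2 * b - d, a + 1 - of_nat N - \<mu> - 2 * b - e] n
      / mpoch (C_lower1 N a b d e \<mu>) n
    * (mpoch [2 * a + 2 - \<mu> - 2 * b - d - e, a + 2 - of_nat N - d - e, a + 1] n
      / mpoch (C_lower2 N a b d e \<mu>) n)"

definition s_par :: "nat \<Rightarrow> complex \<Rightarrow> complex \<Rightarrow> complex \<Rightarrow> complex \<Rightarrow> complex \<Rightarrow> complex" where
  "s_par N a b d e \<mu> = 2 * a + 1 - of_nat N - 2 * b - d - e - \<mu>"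

text \<open>The squared norm. The published constant \<open>C_printed\<close> lacks the factor
  \<open>(s + n) / (s + 2n)\<close> (which is 1 for \<open>n = 0\<close>), where \<open>s + n\<close> is the eighth upper parameter of
  \<open>U\<^sub>n\<close>; without it the identity is false, see \<open>C_printed_incorrect\<close> below.\<close>
definition C_norm ::
  "nat \<Rightarrow> complex \<Rightarrow> complex \<Rightarrow> complex \<Rightarrow> complex \<Rightarrow> complex \<Rightarrow> nat \<Rightarrow> complex" where
  "C_norm N a b d e \<mu> n = C_printed N a b d e \<mu> n *
    (if n = 0 then 1
     else (s_par N a b d e \<mu> + of_nat n) / (s_par N a b d e \<mu> + 2 * of_nat n))"

text \<open>No denominator occurring in \<open>U\<^sub>n(x\<^sub>k)\<close>, \<open>V\<^sub>m(x\<^sub>k)\<close>, \<open>r\<^sub>k\<close> (for \<open>k \<le> N\<close>) or \<open>C\<^sub>n\<close> vanishes.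
  At \<open>x\<^sub>k\<close> one takes \<open>u = b + k\<close>; the other choice of \<open>u\<close> only swaps two lower parameters.
  The last conjunct concerns the factor added in \<open>C_norm\<close>, which is irrelevant for \<open>n \<noteq> m\<close>.\<close>
definition no_zero_denominators ::
  "nat \<Rightarrow> complex \<Rightarrow> complex \<Rightarrow> complex \<Rightarrow> complex \<Rightarrow> complex \<Rightarrow> nat \<Rightarrow> nat \<Rightarrow> bool" where
  "no_zero_denominators N a b d e \<mu> n m \<longleftrightarrow>
    (\<forall>k\<le>N. \<forall>j\<le>n. mpoch (U_lower N a b d e \<mu> n (b + of_nat k) @ [1]) j \<noteq> 0) \<and>
    (\<forall>k\<le>N. \<forall>j\<le>m. mpoch (V_lower N a b d e \<mu> m (b + of_nat k) @ [1]) j \<noteq> 0) \<and>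
    (\<forall>k\<le>N. mpoch (r_lower N a b d e \<mu>) k \<noteq> 0) \<and>
    mpoch (r_const_lower a b d e \<mu>) N \<noteq> 0 \<and>
    mpoch (C_lower1 N a b d e \<mu>) n \<noteq> 0 \<and>
    mpoch (C_lower2 N a b d e \<mu>) n \<noteq> 0 \<and>
    (n = m \<and> n \<noteq> 0 \<longrightarrow> s_par N a b d e \<mu> + 2 * of_nat n \<noteq> 0)"

lemma C_printed_incorrect:
  shows "no_zero_denominators 1 2 0 (-1) (-1) 1 1 1"
    and "(\<Sum>k=0..1. U 1 2 0 (-1) (-1) 1 1 (x_pt 0 1 k) * V 1 2 0 (-1) (-1) 1 1 (x_pt 0 1 k)
            * r_weight 1 2 0 (-1) (-1) 1 k) = - 5 / 4"
    and "C_printed 1 2 0 (-1) (-1) 1 1 = - 35 / 24"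
    and "C_norm 1 2 0 (-1) (-1) 1 1 = - 5 / 4"
proof -
  have le1: "k \<le> 1 \<longleftrightarrow> k = 0 \<or> k = 1" for k :: nat
    by auto
  show "no_zero_denominators 1 2 0 (-1) (-1) 1 1 1"
    unfolding no_zero_denominators_def le1
    by (auto simp: mpoch_def U_lower_def V_lower_def r_lower_def r_const_lower_def
        C_lower1_def C_lower2_def s_par_def Let_def)
  show "(\<Sum>k=0..1. U 1 2 0 (-1) (-1) 1 1 (x_pt 0 1 k) * V 1 2 0 (-1) (-1) 1 1 (x_pt 0 1 k)
            * r_weight 1 2 0 (-1) (-1) 1 k) = - 5 / 4"
    unfolding x_pt_def U_eq V_eq
    by (simp add: U_par_def V_par_def hyp_term_def mpoch_def U_upper_def U_lower_def
        V_upper_def V_lower_def r_weight_def r_lower_def r_const_lower_def Let_def)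
  show "C_printed 1 2 0 (-1) (-1) 1 1 = - 35 / 24"
    by (simp add: C_printed_def C_lower1_def C_lower2_def mpoch_def)
  then show "C_norm 1 2 0 (-1) (-1) 1 1 = - 5 / 4"
    by (simp add: C_norm_def s_par_def)
qed

end

theory Submission
  imports Defs "HOL-Computational_Algebra.Polynomial"
begin

text \<open>
  Put \<open>A = \<mu> + 2b\<close>, \<open>p = a - d + 1\<close>, \<open>q = a - e + 1\<close> and \<open>f = A - a\<close>. At \<open>u = b + k\<close> the weight is,
  up to a constant, the \<open>k\<close>-th term of Dougall's very-well-poised series with base \<open>A\<close> and parameters
  \<open>f, h, p, q, -N\<close>, and \<open>V\<close> arises from \<open>U\<close> by exchanging \<open>f\<close> and \<open>h\<close>, which replaces \<open>a\<close>
  by \<open>a' = A - h\<close>. Hence it suffices to treat \<open>m \<le> n\<close>. As a function of \<open>y = k (k + A)\<close>, \<open>V\<^sub>m\<close> is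
  a combination of \<open>\<psi>\<^sub>0, \<dots>, \<psi>\<^sub>m\<close>, where \<open>\<psi>\<^sub>i\<close> has the same poles but zeros that shift the parameter \<open>p\<close>
  of the weight. Pairing \<open>\<psi>\<^sub>i\<close> with the \<open>j\<close>-th term of \<open>U\<^sub>n\<close> then gives another Dougall series, and
  so does the remaining sum over \<open>j\<close>; its value contains the factor \<open>(-i)\<^sub>n\<close>, which vanishes for \<open>i < n\<close>.
  The norm only needs the leading coefficient of \<open>V\<^sub>n\<close>, a residue at the last pole.

  All this is done for parameters none of whose relevant combinations is an integer. The general case
  follows by moving the parameters along a line on which they are generic near the given point.
\<close>

subsection \<open>Dougall's summation\<close>

lemma pochhammer_nonzero_if_not_Ints:
  fixes x :: "'a::field_char_0"
  assumes "x \<notin> \<int>"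
  shows "pochhammer x n \<noteq> 0"
proof
  assume "pochhammer x n = 0"
  then obtain k where "x = - of_nat k"
    by (auto simp: pochhammer_eq_0_iff)
  with assms show False
    by simp
qed

lemma add_of_nat_nonzero_if_not_Ints:
  fixes x :: "'a::field_char_0"
  assumes "x \<notin> \<int>"
  shows "x + of_nat k \<noteq> 0"
  using assms by (metis Ints_minus Ints_of_nat add_eq_0_iff2)

text \<open>The factor \<open>(1 + A/2)\<^sub>k / (A/2)\<^sub>k\<close> of a very-well-poised series is written as \<open>(A + 2k) / A\<close>.\<close>
definition vwp :: "'a::field_char_0 \<Rightarrow> 'a list \<Rightarrow> nat \<Rightarrow> 'a" where
  "vwp A xs k = (A + 2 * of_nat k) / A * (pochhammer A k / fact k)
     * (\<Prod>x\<leftarrow>xs. pochhammer x k / pochhammer (A + 1 - x) k)"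

lemma pochhammer_shift1:
  fixes x :: "'a::field_char_0"
  shows "x * pochhammer (x + 1) k = pochhammer x k * (x + of_nat k)"
  by (metis pochhammer_Suc pochhammer_rec)

text \<open>The identity behind the Wilf-Zeilberger certificate \<open>G\<close> below.\<close>
lemma dougall_polynomial_identity:
  fixes A f p q n k h M :: "'a::field_char_0"
  assumes M: "M = A + 1 + n" and h: "h = 2 * A + 1 + n - f - p - q"
  shows "(M - f) * (M - p) * (M - q) * (A + 2 * k) * (h + k) * (A - h + k) * (n + 1)
      + (M - f - p) * (M - f - q) * (M - p - q) * (A + 2 * k) * (n + 1 - k) * h * (M + k)
    = (h + n + 1) * ((A + k) * (f + k) * (p + k) * (q + k) * (h + k) * (n + 1 - k)
      + k * (A - f + k) * (A - p + k) * (A - q + k) * (A - h + k) * (M + k))"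
  unfolding M h by algebra

text \<open>Stated without division by the factors of the right-hand side, which vanish in the application
  that yields the orthogonality.\<close>
lemma dougall_step:
  fixes A f p q :: "'a::field_char_0"
  assumes A: "A \<notin> \<int>" "A - f \<notin> \<int>" "A - p \<notin> \<int>" "A - q \<notin> \<int>"
    and h: "f + p + q - A \<notin> \<int>" "2 * A - f - p - q \<notin> \<int>"
  defines "t \<equiv> \<lambda>N. vwp A [f, p, q, 2 * A + 1 + of_nat N - f - p - q, - of_nat N]"
  defines "M \<equiv> \<lambda>N. A + 1 + of_nat N"
  shows "(M N - f) * (M N - p) * (M N - q) * (M N - f - p - q) * (\<Sum>k\<le>Suc N. t (Suc N) k)
    = M N * ((M N - f - p) * (M N - f - q) * (M N - p - q)) * (\<Sum>k\<le>N. t N k)"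
proof -
  define m where "m = M N"
  define n where "n = (of_nat N :: 'a)"
  define h where "h = 2 * A + 1 + n - f - p - q"
  \<comment> \<open>The common factor of \<open>t N k\<close> and \<open>t (Suc N) k\<close>: the
    pair belonging to \<open>h\<close> and the lower \<open>m\<close> come from \<open>N\<close>,
    the upper \<open>- n - 1\<close> comes from \<open>Suc N\<close>. Each term is then
    \<open>B k\<close> times a few linear factors.\<close>
  define B where "B = (\<lambda>k. pochhammer A k / fact k * (pochhammer f k / pochhammer (A + 1 - f) k)
     * (pochhammer p k / pochhammer (A + 1 - p) k) * (pochhammer q k / pochhammer (A + 1 - q) k)
     * (pochhammer h k / pochhammer (A + 1 - h) k) * (pochhammer (- n - 1) k / pochhammer m k))"
  define c where "c = (h + n + 1) * m / (h * (A * (n + 1)))"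
  \<comment> \<open>The factors \<open>A - f + k\<close> etc. cancel the newest denominators of
    \<open>B (Suc k)\<close>, so that \<open>G (Suc k)\<close> and \<open>G k\<close> are both
    rational multiples of \<open>B k\<close>. The factor \<open>k\<close> kills \<open>G 0\<close>;
    the constant \<open>c\<close> is the one that fits
    \<open>dougall_polynomial_identity\<close>.\<close>
  define G where "G = (\<lambda>k. c * B k * of_nat k * (A - f + of_nat k) * (A - p + of_nat k)
     * (A - q + of_nat k) * (A - h + of_nat k))"
  have mA: "m = A + (1 + of_nat N)" by (simp add: m_def M_def)
  have notint: "A \<notin> \<int>" "A + 1 - f \<notin> \<int>" "A + 1 - p \<notin> \<int>" "A + 1 - q \<notin> \<int>" "A + 1 - h \<notin> \<int>"
      "h \<notin> \<int>" "m \<notin> \<int>" "A - h \<notin> \<int>"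
  proof -
    have *: "x \<notin> \<int>" if "y \<notin> \<int>" "x = y + z \<or> x = z - y" "z \<in> \<int>" for x y z :: 'a
      using that by (metis Ints_diff add_diff_cancel_right' diff_diff_eq2 diff_add_cancel add.commute)
    show "A \<notin> \<int>" by fact
    show "A + 1 - f \<notin> \<int>" by (rule *[OF A(2), of _ 1]) auto
    show "A + 1 - p \<notin> \<int>" by (rule *[OF A(3), of _ 1]) auto
    show "A + 1 - q \<notin> \<int>" by (rule *[OF A(4), of _ 1]) auto
    show "A + 1 - h \<notin> \<int>" by (rule *[OF h(1), of _ "- n"]) (auto simp: h_def n_def)
    show "A - h \<notin> \<int>" by (rule *[OF h(1), of _ "- n - 1"]) (auto simp: h_def n_def)
    show "h \<notin> \<int>" by (rule *[OF h(2), of _ "n + 1"]) (auto simp: h_def n_def)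
    show "m \<notin> \<int>" by (rule *[OF A(1), of _ "n + 1"]) (auto simp: mA n_def)
  qed
  have nz: "A \<noteq> 0" "h \<noteq> 0" "A - h \<noteq> 0" "m \<noteq> 0" "n + 1 \<noteq> 0"
    using notint of_nat_neq_0[of N, where 'a='a] by (auto simp: n_def add.commute)
  have nzk: "m + of_nat k \<noteq> 0" "A - h + of_nat k \<noteq> 0" for k
    using notint by (auto intro!: add_of_nat_nonzero_if_not_Ints)
  have t0: "t N k = B k * ((A + 2 * of_nat k) / A * ((n + 1 - of_nat k) / (n + 1)))" for k
  proof -
    have "pochhammer (- n) k = pochhammer (- n - 1) k * ((n + 1 - of_nat k) / (n + 1))"
    proof -
      have "(n + 1) * pochhammer (- n) k = (n + 1 - of_nat k) * pochhammer (- n - 1) k"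
        using pochhammer_shift1[of "- n - 1" k] by (simp add: algebra_simps)
      then show ?thesis using nz(5) by (simp add: field_simps)
    qed
    moreover have "A + 1 - (- n) = m" by (simp add: mA n_def)
    ultimately show ?thesis
      unfolding t_def vwp_def n_def[symmetric] h_def[symmetric] by (simp add: B_def mult_ac)
  qed
  have t1: "t (Suc N) k = B k * ((A + 2 * of_nat k) / A * ((h + of_nat k) / h)
      * ((A - h + of_nat k) / (A - h)) * (m / (m + of_nat k)))" for k
  proof -
    have 1: "pochhammer (h + 1) k = pochhammer h k * ((h + of_nat k) / h)"
      using pochhammer_shift1[of h k] nz by (simp add: field_simps)
    have 2: "pochhammer (A - h) k = pochhammer (A + 1 - h) k / ((A - h + of_nat k) / (A - h))"
      using pochhammer_shift1[of "A - h" k] nz nzk by (simp add: field_simps)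
    have 3: "pochhammer (m + 1) k = pochhammer m k / (m / (m + of_nat k))"
      using pochhammer_shift1[of m k] nz nzk by (simp add: field_simps)
    have e: "2 * A + 1 + of_nat (Suc N) - f - p - q = h + 1" "- of_nat (Suc N) = - n - 1"
         "A + 1 - (h + 1) = A - h" "A + 1 - (- n - 1) = m + 1"
      by (simp_all add: h_def n_def mA)
    show ?thesis
      unfolding t_def vwp_def list.map prod_list.Cons prod_list.Nil e by (simp add: B_def 1 2 3 mult_ac)
  qed
  define P where "P = (m - f) * (m - p) * (m - q)"
  define Q where "Q = (m - f - p) * (m - f - q) * (m - p - q)"
  have hA: "m - f - p - q = h - A"
    by (simp add: mA h_def n_def)
  have step: "P * (h - A) * t (Suc N) k - m * Q * t N k = G (Suc k) - G k" for k
  proof -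
    define x where "x = (of_nat k :: 'a)"
    define R where "R = (A + x) * (f + x) * (p + x) * (q + x) * (h + x) * (n + 1 - x)"
    define S where "S = x * (A - f + x) * (A - p + x) * (A - q + x) * (A - h + x)"
    have BS: "B (Suc k) * of_nat (Suc k) * (A + 1 - f + x) * (A + 1 - p + x) * (A + 1 - q + x)
        * (A + 1 - h + x) = - B k * R / (m + x)"
    proof -
      have "A + 1 - f + x \<noteq> 0" "A + 1 - p + x \<noteq> 0" "A + 1 - q + x \<noteq> 0" "A + 1 - h + x \<noteq> 0"
          "(1 + x) \<noteq> 0"
        using notint by (auto simp: x_def intro!: add_of_nat_nonzero_if_not_Ints simp flip: of_nat_Suc)
      moreover define w where "w = n + 1 - x"
      moreover have e: "- n - 1 + x = - w" by (simp add: w_def)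
      ultimately show ?thesis
        unfolding B_def R_def pochhammer_Suc fact_Suc of_nat_Suc x_def[symmetric] e w_def[symmetric]
        by (simp add: divide_simps mult_ac)
    qed
    have GS: "G (Suc k) = - c * B k * R / (m + x)"
    proof -
      have *: "A - y + of_nat (Suc k) = A + 1 - y + x" for y
        by (simp add: x_def)
      show ?thesis
        using arg_cong[OF BS, of "\<lambda>z. c * z"] unfolding G_def * by (simp add: mult_ac)
    qed
    have G: "G k = c * B k * S"
      by (simp add: G_def S_def x_def mult_ac)
    have key: "P * (A + 2 * x) * (h + x) * (A - h + x) * (n + 1)
        + Q * (A + 2 * x) * (n + 1 - x) * h * (m + x) = (h + n + 1) * (R + S * (m + x))"
      using dougall_polynomial_identity[of m A n h f p q x]
      by (simp add: P_def Q_def R_def S_def mA h_def n_def mult_ac add_ac)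
    have "G (Suc k) - G k = - c * B k / (m + x) * (R + S * (m + x))"
      using nzk[of k] by (simp add: GS G flip: x_def) (simp add: field_simps)
    also have "\<dots> = - B k * m / (h * (A * (n + 1)) * (m + x)) * ((h + n + 1) * (R + S * (m + x)))"
      by (simp add: c_def)
    also have "\<dots> = P * (h - A) * t (Suc N) k - m * Q * t N k"
      unfolding t0 t1 key[symmetric] x_def[symmetric]
      using nz nzk[of k] by (simp add: divide_simps flip: x_def) (simp add: algebra_simps)
    finally show ?thesis ..
  qed
  \<comment> \<open>Both sums run to \<open>Suc N\<close> so that one telescoping serves both; the
    extra term \<open>t N (Suc N)\<close> is zero because of its factor
    \<open>n + 1 - k\<close>.\<close>
  have "P * (h - A) * (\<Sum>k\<le>Suc N. t (Suc N) k) - m * Q * (\<Sum>k\<le>Suc N. t N k)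
      = (\<Sum>k\<le>Suc N. G (Suc k) - G k)"
    by (simp only: step[symmetric] sum_distrib_left sum_subtractf)
  also have "\<dots> = G (Suc (Suc N)) - G 0"
    by (subst sum_telescope[of "\<lambda>k. - G k", simplified]) simp
  also have "G (Suc (Suc N)) = 0"
  proof -
    have "- n - 1 = - (of_nat (Suc N) :: 'a)" by (simp add: n_def)
    then have "pochhammer (- n - 1) (Suc (Suc N)) = 0"
      by (simp only: pochhammer_of_nat_eq_0_iff)
    then show ?thesis by (simp add: G_def B_def)
  qed
  also have "G 0 = 0" by (simp add: G_def)
  also have "(\<Sum>k\<le>Suc N. t N k) = (\<Sum>k\<le>N. t N k)"
    using t0[of "Suc N"] by (simp add: n_def)
  finally show ?thesis
    by (simp add: P_def Q_def hA flip: m_def)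
qed

text \<open>Induction on \<open>N\<close> by \<open>dougall_step\<close>, whose left-hand factors
  are nonzero here. The two conditions \<open>h\<close> say that the fourth parameter and its
  partner in the denominator are non-integral, for every \<open>N\<close> at once.\<close>

lemma dougall_7F6:
  fixes A f p q :: "'a::field_char_0"
  assumes A: "A \<notin> \<int>" "A - f \<notin> \<int>" "A - p \<notin> \<int>" "A - q \<notin> \<int>"
    and h: "f + p + q - A \<notin> \<int>" "2 * A - f - p - q \<notin> \<int>"
  shows "(\<Sum>k\<le>N. vwp A [f, p, q, 2 * A + 1 + of_nat N - f - p - q, - of_nat N] k)
    = pochhammer (A + 1) N * pochhammer (A + 1 - f - p) N * pochhammer (A + 1 - f - q) N
        * pochhammer (A + 1 - p - q) N
      / (pochhammer (A + 1 - f) N * pochhammer (A + 1 - p) N * pochhammer (A + 1 - q) N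
        * pochhammer (A + 1 - f - p - q) N)"
proof (induction N)
  case 0
  have "A \<noteq> 0" using A by auto
  then show ?case by (simp add: vwp_def)
next
  case (Suc N)
  have nz: "A + 1 + of_nat N - f \<noteq> 0" "A + 1 + of_nat N - p \<noteq> 0" "A + 1 + of_nat N - q \<noteq> 0"
     "A + 1 + of_nat N - f - p - q \<noteq> 0"
  proof -
    have *: "A + 1 + of_nat N - y \<noteq> 0" if "A - y \<notin> \<int>" for y
      using add_of_nat_nonzero_if_not_Ints[OF that, of "Suc N"] by (simp add: algebra_simps)
    have "A - (f + p + q) \<notin> \<int>" using h(1) by (metis Ints_minus minus_diff_eq)
    then show "A + 1 + of_nat N - f - p - q \<noteq> 0" using *[of "f + p + q"] by (simp add: algebra_simps)
    show "A + 1 + of_nat N - f \<noteq> 0" "A + 1 + of_nat N - p \<noteq> 0" "A + 1 + of_nat N - q \<noteq> 0"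
      using A by (auto intro!: *)
  qed
  have sh: "pochhammer (A + 1 - y) (Suc N) = pochhammer (A + 1 - y) N * (A + 1 + of_nat N - y)"
     "pochhammer (A + 1 - y - z) (Suc N) = pochhammer (A + 1 - y - z) N * (A + 1 + of_nat N - y - z)"
     "pochhammer (A + 1 - y - z - w) (Suc N) = pochhammer (A + 1 - y - z - w) N * (A + 1 + of_nat N - y - z - w)"
     "pochhammer (A + 1) (Suc N) = pochhammer (A + 1) N * (A + 1 + of_nat N)"
     for y z w
    by (simp_all add: pochhammer_Suc algebra_simps)
  define S where "S = (\<Sum>k\<le>Suc N. vwp A [f, p, q, 2 * A + 1 + of_nat (Suc N) - f - p - q, - of_nat (Suc N)] k)"
  define M where "M = A + 1 + of_nat N"
  have "(M - f) * (M - p) * (M - q) * (M - f - p - q) * S = M * ((M - f - p) * (M - f - q) * (M - p - q)) *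
     (pochhammer (A + 1) N * pochhammer (A + 1 - f - p) N * pochhammer (A + 1 - f - q) N
        * pochhammer (A + 1 - p - q) N
      / (pochhammer (A + 1 - f) N * pochhammer (A + 1 - p) N * pochhammer (A + 1 - q) N
        * pochhammer (A + 1 - f - p - q) N))"
    using dougall_step[OF assms, of N] unfolding Suc.IH S_def M_def .
  then have "S = M * ((M - f - p) * (M - f - q) * (M - p - q)) *
     (pochhammer (A + 1) N * pochhammer (A + 1 - f - p) N * pochhammer (A + 1 - f - q) N
        * pochhammer (A + 1 - p - q) N
      / (pochhammer (A + 1 - f) N * pochhammer (A + 1 - p) N * pochhammer (A + 1 - q) N
        * pochhammer (A + 1 - f - p - q) N)) / ((M - f) * (M - p) * (M - q) * (M - f - p - q))"
    using nz by (metis M_def mult_eq_0_iff nonzero_mult_div_cancel_left)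
  then show ?case
    unfolding sh S_def[symmetric] M_def[symmetric]
    by (simp add: mult_ac)
qed

section \<open>Shifting parameters and indices in Pochhammer symbols\<close>

text \<open>Non-integrality is invariant under sign change and integer translation. Nearly all side
  conditions below reduce in this way to one of the linear forms assumed generic.\<close>

lemma not_Ints_shift:
  fixes x y :: "'a::ring_1"
  assumes "x \<notin> \<int>" and "y - x \<in> \<int> \<or> y + x \<in> \<int>"
  shows "y \<notin> \<int>"
  using assms by (metis Ints_diff add_diff_cancel_left' diff_diff_eq2)

lemma pochhammer_reflect:
  fixes x :: "'a::comm_ring_1"
  shows "pochhammer (1 - x - of_nat n) n = (- 1) ^ n * pochhammer x n"
  using pochhammer_minus[of "x + of_nat n - 1" n] by (simp add: algebra_simps)

text \<open>Multiplying by \<open>(B + k)_i\<close> prolongs \<open>(B)_k\<close> at its end, and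
  \<open>(1 - x - k)_i\<close> is up to sign the product of the last \<open>i\<close> factors that
  \<open>(x)_k\<close> loses. If \<open>B = A + 1 - x\<close>, the new pair \<open>x - i\<close>,
  \<open>B + i\<close> is again well-poised for \<open>A\<close>.\<close>

lemma pochhammer_ratio_shift:
  fixes x B :: "'a::field_char_0"
  assumes "x \<notin> \<int>" "B \<notin> \<int>"
  shows "pochhammer x k / pochhammer B k / (pochhammer (B + of_nat k) i * pochhammer (1 - x - of_nat k) i)
    = (- 1) ^ i / (pochhammer (x - of_nat i) i * pochhammer B i)
      * (pochhammer (x - of_nat i) k / pochhammer (B + of_nat i) k)"
proof -
  have ni: "x - of_nat i \<notin> \<int>" "B + of_nat i \<notin> \<int>" "B + of_nat k \<notin> \<int>" "x + of_nat k - of_nat i \<notin> \<int>"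
    using assms by (auto intro: not_Ints_shift[of x] not_Ints_shift[of B])
  have nz: "pochhammer B k \<noteq> 0" "pochhammer (B + of_nat k) i \<noteq> 0"
      "pochhammer (x + of_nat k - of_nat i) i \<noteq> 0" "pochhammer (x - of_nat i) i \<noteq> 0"
      "pochhammer B i \<noteq> 0" "pochhammer (B + of_nat i) k \<noteq> 0"
    using assms ni by (simp_all add: pochhammer_nonzero_if_not_Ints)
  have 1: "pochhammer (1 - x - of_nat k) i = (- 1) ^ i * pochhammer (x + of_nat k - of_nat i) i"
    using pochhammer_reflect[of "x + of_nat k - of_nat i" i] by (simp add: algebra_simps)
  have 2: "pochhammer x k
      = pochhammer (x - of_nat i) k * pochhammer (x + of_nat k - of_nat i) i / pochhammer (x - of_nat i) i"
    using pochhammer_product'[of "x - of_nat i" i k] pochhammer_product'[of "x - of_nat i" k i] nz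
    by (simp add: field_simps)
  have 3: "pochhammer (B + of_nat k) i = pochhammer B i * pochhammer (B + of_nat i) k / pochhammer B k"
    using pochhammer_product'[of B i k] pochhammer_product'[of B k i] nz by (simp add: field_simps)
  show ?thesis
    unfolding 1 2 3 using nz by (cases "even i") (simp_all add: divide_simps)
qed

text \<open>The reciprocal of the previous identity with \<open>x\<close> and \<open>B\<close>
  exchanged, for parameters that move upwards.\<close>

lemma pochhammer_ratio_shift':
  fixes x B :: "'a::field_char_0"
  assumes "x \<notin> \<int>" "B \<notin> \<int>"
  shows "pochhammer x k / pochhammer B k * (pochhammer (x + of_nat k) i * pochhammer (1 - B - of_nat k) i)
    = (- 1) ^ i * (pochhammer (B - of_nat i) i * pochhammer x i)
      * (pochhammer (x + of_nat i) k / pochhammer (B - of_nat i) k)"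
  using arg_cong[OF pochhammer_ratio_shift[OF assms(2,1), of k i], of inverse]
  by (cases "even i") (simp_all add: field_simps)

text \<open>Starting the index at \<open>j\<close> turns the base \<open>A\<close> into
  \<open>A + 2j\<close>: \<open>(-k)_j\<close> changes \<open>k!\<close> into \<open>l!\<close> for
  \<open>k = j + l\<close>, and \<open>(A)_k (A + k)_j = (A)_{2j} (A + 2j)_l\<close>.\<close>

lemma vwp_head_shift:
  fixes A :: "'a::field_char_0"
  assumes "A \<notin> \<int>"
  shows "(A + 2 * of_nat (j + l)) / A * (pochhammer A (j + l) / fact (j + l))
      * (pochhammer (- of_nat (j + l)) j * pochhammer (A + of_nat (j + l)) j)
    = (- 1) ^ j * ((A + 2 * of_nat j) / A * pochhammer A (2 * j))
      * ((A + 2 * of_nat j + 2 * of_nat l) / (A + 2 * of_nat j)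
        * (pochhammer (A + 2 * of_nat j) l / fact l))"
proof -
  have 1: "pochhammer (- of_nat (j + l)) j = ((- 1) ^ j * (fact (j + l) / fact l) :: 'a)"
    using pochhammer_minus[of "of_nat (j + l) :: 'a" j] pochhammer_product'[of "1::'a" l j]
      fact_nonzero[of l, where 'a='a]
    by (simp add: pochhammer_fact field_simps)
  have e: "j + l + j = 2 * j + l" by simp
  have 2: "pochhammer A (j + l) * pochhammer (A + of_nat (j + l)) j
      = pochhammer A (2 * j) * pochhammer (A + 2 * of_nat j) l"
    using pochhammer_product'[of A "j + l" j, unfolded e] pochhammer_product'[of A "2 * j" l]
    by simp
  have nz: "A \<noteq> 0" "A + 2 * of_nat j \<noteq> 0"
    using assms add_of_nat_nonzero_if_not_Ints[OF assms, of "2 * j"] by auto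
  define B where "B = A + 2 * of_nat j"
  have 3: "A + 2 * of_nat (j + l) = B + 2 * of_nat l"
    by (simp add: B_def)
  have "(A + 2 * of_nat (j + l)) / A * (pochhammer A (j + l) / fact (j + l))
      * (pochhammer (- of_nat (j + l)) j * pochhammer (A + of_nat (j + l)) j)
    = (A + 2 * of_nat (j + l)) / A * (- 1) ^ j / fact l
      * (pochhammer A (j + l) * pochhammer (A + of_nat (j + l)) j)"
    unfolding 1 by (simp add: divide_inverse mult_ac flip: inverse_mult_distrib)
  also have "\<dots> = (- 1) ^ j * ((A + 2 * of_nat j) / A * pochhammer A (2 * j))
      * ((A + 2 * of_nat j + 2 * of_nat l) / (A + 2 * of_nat j)
        * (pochhammer (A + 2 * of_nat j) l / fact l))"
    unfolding 2 3 B_def[symmetric] using nz(1) nz(2)[folded B_def] by (simp add: mult_ac)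
  finally show ?thesis .
qed

subsection \<open>Biorthogonality for generic parameters\<close>

text \<open>Up to sign and integers the list is closed under exchanging \<open>p\<close> and
  \<open>q\<close> and under replacing \<open>a\<close> by \<open>p + q - a\<close>. The latter is
  the passage from \<open>a\<close> to \<open>a'\<close>, so the locale can be interpreted once more
  with the roles of \<open>U\<close> and \<open>V\<close> exchanged.\<close>

locale generic_parameters =
  fixes A a p q :: "'a::field_char_0" and N :: nat
  assumes generic: "A \<notin> \<int>" "a \<notin> \<int>" "p \<notin> \<int>" "q \<notin> \<int>" "A - a \<notin> \<int>" "A - p \<notin> \<int>" "A - q \<notin> \<int>"
    "a - p \<notin> \<int>" "a - q \<notin> \<int>" "p + q - A \<notin> \<int>" "p + q - a \<notin> \<int>" "A + a - p - q \<notin> \<int>"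
    "2 * p + q - A - a \<notin> \<int>" "p + 2 * q - A - a \<notin> \<int>" "A - a - p \<notin> \<int>" "A - a - q \<notin> \<int>"
begin

definition f where "f = A - a"
text \<open>\<open>h\<close> is forced by Dougall's balancing condition
  \<open>f + h + p + q - N = 2 * A + 1\<close>, and \<open>a' = A - h\<close> just as
  \<open>a = A - f\<close>. Note that \<open>s\<close>, the same for both families, does not involve
  \<open>a\<close>.\<close>

definition h where "h = A + a + 1 + of_nat N - p - q"
definition s where "s = p + q - A - 1 - of_nat N"
definition a' where "a' = p + q - a - 1 - of_nat N"

lemmas notint_shift = generic[THEN not_Ints_shift]

lemmas fhs_defs = f_def h_def s_def a'_def

definition w where "w = vwp A [f, h, p, q, - of_nat N]"

text \<open>\<open>Ux n = (\<Sum>j\<le>n. c n j * \<phi> j)\<close>; multiplying the weight by \<open>\<phi> j * \<psi> i\<close> shifts its parameters.\<close>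

definition \<phi> where
  "\<phi> j k = pochhammer (- of_nat k) j * pochhammer (A + of_nat k) j
     / (pochhammer (a + 1 + of_nat k) j * pochhammer (a + 1 - A - of_nat k) j)"

definition \<psi> where
  "\<psi> i k = pochhammer (p + of_nat k) i * pochhammer (p - A - of_nat k) i
     / (pochhammer (a' + 1 + of_nat k) i * pochhammer (1 - h - of_nat k) i)"

definition c where
  "c n j = vwp a [a + 1 - p, a + 1 - q, a + 1 + of_nat N, s + of_nat n, - of_nat n] j"

definition K where
  "K i = pochhammer p i * pochhammer (A + 1 - p - of_nat i) i
      / (pochhammer (h - of_nat i) i * pochhammer (a' + 1) i)"

text \<open>Everything in the shifted summand that does not depend on \<open>l\<close>;
  \<open>K i\<close> is the portion coming from the shifts by \<open>i\<close> alone.\<close>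

definition E where
  "E i j = (A + 2 * of_nat j) / A * pochhammer A (2 * j) / pochhammer (a + 1) (2 * j) * K i
    * (pochhammer (h - of_nat i) j / pochhammer (a' + 1 + of_nat i) j)
    * (pochhammer (p + of_nat i) j / pochhammer (A + 1 - p - of_nat i) j)
    * (pochhammer q j / pochhammer (A + 1 - q) j)
    * (pochhammer (- of_nat N) j / pochhammer (A + 1 + of_nat N) j)"

text \<open>Each Pochhammer ratio of the weight absorbs the factors of \<open>\<phi> j\<close> or
  \<open>\<psi> i\<close> that match it and is then restarted at index \<open>j\<close>. The result
  is again very-well-poised, with base \<open>A + 2j\<close>.\<close>

lemma summand_shift:
  "w (j + l) * \<phi> j (j + l) * \<psi> i (j + l) = E i j
     * vwp (A + 2 * of_nat j) [f, p + of_nat i + of_nat j, q + of_nat j, h - of_nat i + of_nat j,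
         - of_nat N + of_nat j] l"
proof -
  have notint: "f \<notin> \<int>" "a + 1 \<notin> \<int>" "h \<notin> \<int>" "a' + 1 \<notin> \<int>" "p \<notin> \<int>" "A + 1 - p \<notin> \<int>"
      "f - of_nat j \<notin> \<int>"
    by (rule notint_shift(5), simp add: fhs_defs)
      (rule notint_shift(2), simp, rule notint_shift(12), simp add: fhs_defs,
       rule notint_shift(11), simp add: fhs_defs, rule notint_shift(3), simp,
       rule notint_shift(6), simp, rule notint_shift(5), simp add: fhs_defs)
  define k where "k = j + l"
  \<comment> \<open>The blocks \<open>L1\<close> to \<open>L6\<close> pair the head and the
    parameters \<open>f\<close>, \<open>h\<close>, \<open>p\<close>, \<open>q\<close>,
    \<open>-N\<close> with the factors that shift them: \<open>\<phi> j\<close> acts on the head and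
    on \<open>f\<close>, \<open>\<psi> i\<close> on \<open>h\<close> and \<open>p\<close>.\<close>
  define L2 where "L2 = pochhammer f k / pochhammer (a + 1) k
      / (pochhammer (a + 1 + of_nat k) j * pochhammer (1 - f - of_nat k) j)"
  define L3 where "L3 = pochhammer h k / pochhammer (a' + 1) k
      / (pochhammer (a' + 1 + of_nat k) i * pochhammer (1 - h - of_nat k) i)"
  define L4 where "L4 = pochhammer p k / pochhammer (A + 1 - p) k
      * (pochhammer (p + of_nat k) i * pochhammer (1 - (A + 1 - p) - of_nat k) i)"
  define L5 where "L5 = pochhammer q k / pochhammer (A + 1 - q) k"
  define L6 where "L6 = pochhammer (- of_nat N) k / pochhammer (A + 1 + of_nat N) k"
  define L1 where "L1 = (A + 2 * of_nat k) / A * (pochhammer A k / fact k)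
      * (pochhammer (- of_nat k) j * pochhammer (A + of_nat k) j)"
  have e: "A + 1 - f = a + 1" "A + 1 - h = a' + 1" "A + 1 - - of_nat N = A + 1 + of_nat N"
      "1 - f - of_nat k = a + 1 - A - of_nat k" "1 - (A + 1 - p) - of_nat k = p - A - of_nat k"
    by (simp_all add: fhs_defs algebra_simps)
  have lhs: "w k * \<phi> j k * \<psi> i k = L1 * L2 * L3 * L4 * L5 * L6"
    unfolding w_def \<phi>_def \<psi>_def vwp_def L1_def L2_def L3_def L4_def L5_def L6_def
      list.map prod_list.Cons prod_list.Nil e
    by (simp add: divide_inverse mult_ac)
  have L1: "L1 = (- 1) ^ j * ((A + 2 * of_nat j) / A * pochhammer A (2 * j))
      * ((A + 2 * of_nat j + 2 * of_nat l) / (A + 2 * of_nat j)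
        * (pochhammer (A + 2 * of_nat j) l / fact l))"
    unfolding L1_def k_def by (rule vwp_head_shift) (fact generic)
  \<comment> \<open>\<open>\<phi> j\<close> lowers \<open>f\<close> to \<open>f - j\<close>, and
    restarting at index \<open>j\<close> raises it back to \<open>f\<close>. Its partner
    \<open>a + 1\<close> moves up by \<open>j\<close> twice.\<close>
  have L2: "L2 = (- 1) ^ j / pochhammer (a + 1) (2 * j)
      * (pochhammer f l / pochhammer (a + 1 + 2 * of_nat j) l)"
  proof -
    have jk: "j + k = 2 * j + l" by (simp add: k_def)
    have "pochhammer (a + 1) j * pochhammer (a + 1 + of_nat j) k
        = pochhammer (a + 1) (2 * j) * pochhammer (a + 1 + 2 * of_nat j) l"
      using pochhammer_product'[of "a + 1" j k, unfolded jk] pochhammer_product'[of "a + 1" "2 * j" l]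
      by simp
    moreover have "pochhammer (f - of_nat j) k = pochhammer (f - of_nat j) j * pochhammer f l"
      using pochhammer_product'[of "f - of_nat j" j l] by (simp add: k_def)
    moreover have "pochhammer (f - of_nat j) j \<noteq> 0"
      using notint by (simp add: pochhammer_nonzero_if_not_Ints)
    ultimately show ?thesis
      unfolding L2_def pochhammer_ratio_shift[OF notint(1,2)]
      by simp
  qed
  have L3: "L3 = (- 1) ^ i / (pochhammer (h - of_nat i) i * pochhammer (a' + 1) i)
      * (pochhammer (h - of_nat i) j / pochhammer (a' + 1 + of_nat i) j
        * (pochhammer (h - of_nat i + of_nat j) l / pochhammer (a' + 1 + of_nat i + of_nat j) l))"
    unfolding L3_def pochhammer_ratio_shift[OF notint(3,4)]
    unfolding k_def pochhammer_product' by (simp only: times_divide_times_eq)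
  have L4: "L4 = (- 1) ^ i * (pochhammer (A + 1 - p - of_nat i) i * pochhammer p i)
      * (pochhammer (p + of_nat i) j / pochhammer (A + 1 - p - of_nat i) j
        * (pochhammer (p + of_nat i + of_nat j) l / pochhammer (A + 1 - p - of_nat i + of_nat j) l))"
    unfolding L4_def pochhammer_ratio_shift'[OF notint(5,6)]
    unfolding k_def pochhammer_product' by (simp only: times_divide_times_eq)
  have L5: "L5 = pochhammer q j / pochhammer (A + 1 - q) j
      * (pochhammer (q + of_nat j) l / pochhammer (A + 1 - q + of_nat j) l)"
    unfolding L5_def k_def pochhammer_product' by (simp only: times_divide_times_eq)
  have L6: "L6 = pochhammer (- of_nat N) j / pochhammer (A + 1 + of_nat N) j
      * (pochhammer (- of_nat N + of_nat j) l / pochhammer (A + 1 + of_nat N + of_nat j) l)"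
    unfolding L6_def k_def pochhammer_product' by (simp only: times_divide_times_eq)
  define B where "B = A + 2 * of_nat j"
  have e': "B + 1 - f = a + 1 + 2 * of_nat j"
      "B + 1 - (p + of_nat i + of_nat j) = A + 1 - p - of_nat i + of_nat j"
      "B + 1 - (q + of_nat j) = A + 1 - q + of_nat j"
      "B + 1 - (h - of_nat i + of_nat j) = a' + 1 + of_nat i + of_nat j"
      "B + 1 - (- of_nat N + of_nat j) = A + 1 + of_nat N + of_nat j"
    by (simp_all add: fhs_defs B_def algebra_simps)
  have "w k * \<phi> j k * \<psi> i k = E i j
     * vwp B [f, p + of_nat i + of_nat j, q + of_nat j, h - of_nat i + of_nat j,
         - of_nat N + of_nat j] l"
    unfolding lhs L1 L2 L3 L4 L5 L6 E_def K_def vwp_def list.map prod_list.Cons prod_list.Nil e'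
      B_def[symmetric]
    by (cases "even i"; cases "even j") (simp_all add: divide_inverse mult_ac)
  then show ?thesis
    by (simp only: k_def B_def)
qed

definition D where
  "D i j = pochhammer (A + 2 * of_nat j + 1) (N - j) * pochhammer (a + 1 - p - of_nat i + of_nat j) (N - j)
      * pochhammer (a + 1 - q + of_nat j) (N - j) * pochhammer (A + 1 - p - q - of_nat i) (N - j)
    / (pochhammer (a + 1 + 2 * of_nat j) (N - j) * pochhammer (A + 1 - p - of_nat i + of_nat j) (N - j)
      * pochhammer (A + 1 - q + of_nat j) (N - j) * pochhammer (a + 1 - p - q - of_nat i) (N - j))"

text \<open>Terms with \<open>k < j\<close> vanish through \<open>(-k)_j\<close>. The remaining
  series of length \<open>N - j\<close> is still balanced because the shifts of \<open>p\<close> by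
  \<open>i\<close> and of \<open>h\<close> by \<open>-i\<close> cancel, so Dougall's formula gives
  \<open>D i j\<close>.\<close>

lemma inner_sum:
  assumes "j \<le> N"
  shows "(\<Sum>k\<le>N. w k * \<phi> j k * \<psi> i k) = E i j * D i j"
proof -
  have "(\<Sum>k\<le>N. w k * \<phi> j k * \<psi> i k) = (\<Sum>k=j..N. w k * \<phi> j k * \<psi> i k)"
  proof (rule sum.mono_neutral_right)
    show "\<forall>k\<in>{..N} - {j..N}. w k * \<phi> j k * \<psi> i k = 0"
      by (auto simp: \<phi>_def pochhammer_of_nat_eq_0_iff)
  qed auto
  also have "\<dots> = (\<Sum>l\<le>N - j. w (j + l) * \<phi> j (j + l) * \<psi> i (j + l))"
    using sum.shift_bounds_cl_nat_ivl[of "\<lambda>k. w k * \<phi> j k * \<psi> i k" 0 j "N - j"] assms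
    by (simp add: add.commute atMost_atLeast0)
  also have "\<dots> = E i j * (\<Sum>l\<le>N - j. vwp (A + 2 * of_nat j)
      [f, p + of_nat i + of_nat j, q + of_nat j, h - of_nat i + of_nat j, - of_nat N + of_nat j] l)"
    by (simp only: summand_shift sum_distrib_left)
  also have "h - of_nat i + of_nat j = 2 * (A + 2 * of_nat j) + 1 + of_nat (N - j)
      - f - (p + of_nat i + of_nat j) - (q + of_nat j)"
    using assms by (simp add: fhs_defs of_nat_diff)
  also have "- of_nat N + of_nat j = - (of_nat (N - j) :: 'a)"
    using assms by (simp add: of_nat_diff)
  also have "(\<Sum>l\<le>N - j. vwp (A + 2 * of_nat j)
      [f, p + of_nat i + of_nat j, q + of_nat j, 2 * (A + 2 * of_nat j) + 1 + of_nat (N - j)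
      - f - (p + of_nat i + of_nat j) - (q + of_nat j), - of_nat (N - j)] l) = D i j"
  proof (subst dougall_7F6)
    show "A + 2 * of_nat j \<notin> \<int>"
      by (rule not_Ints_shift[OF generic(1)]) simp
    show "A + 2 * of_nat j - f \<notin> \<int>"
      by (rule not_Ints_shift[OF generic(2)]) (simp add: f_def)
    show "A + 2 * of_nat j - (p + of_nat i + of_nat j) \<notin> \<int>"
      by (rule not_Ints_shift[OF generic(6)]) (simp add: algebra_simps)
    show "A + 2 * of_nat j - (q + of_nat j) \<notin> \<int>"
      by (rule not_Ints_shift[OF generic(7)]) (simp add: algebra_simps)
    show "f + (p + of_nat i + of_nat j) + (q + of_nat j) - (A + 2 * of_nat j) \<notin> \<int>"
      by (rule not_Ints_shift[OF generic(11)]) (simp add: algebra_simps f_def)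
    show "2 * (A + 2 * of_nat j) - f - (p + of_nat i + of_nat j) - (q + of_nat j) \<notin> \<int>"
      by (rule not_Ints_shift[OF generic(12)]) (simp add: algebra_simps f_def)
    have "A + 2 * of_nat j + 1 - f - (p + of_nat i + of_nat j) = a + 1 - p - of_nat i + of_nat j"
      "A + 2 * of_nat j + 1 - f - (q + of_nat j) = a + 1 - q + of_nat j"
      "A + 2 * of_nat j + 1 - (p + of_nat i + of_nat j) - (q + of_nat j) = A + 1 - p - q - of_nat i"
      "A + 2 * of_nat j + 1 - f = a + 1 + 2 * of_nat j"
      "A + 2 * of_nat j + 1 - (p + of_nat i + of_nat j) = A + 1 - p - of_nat i + of_nat j"
      "A + 2 * of_nat j + 1 - (q + of_nat j) = A + 1 - q + of_nat j"
      "a + 1 + 2 * of_nat j - (p + of_nat i + of_nat j) - (q + of_nat j) = a + 1 - p - q - of_nat i"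
      by (simp_all add: f_def algebra_simps)
    then show "pochhammer (A + 2 * of_nat j + 1) (N - j) *
       pochhammer (A + 2 * of_nat j + 1 - f - (p + of_nat i + of_nat j)) (N - j) *
       pochhammer (A + 2 * of_nat j + 1 - f - (q + of_nat j)) (N - j) *
       pochhammer (A + 2 * of_nat j + 1 - (p + of_nat i + of_nat j) - (q + of_nat j)) (N - j) /
       (pochhammer (A + 2 * of_nat j + 1 - f) (N - j) *
        pochhammer (A + 2 * of_nat j + 1 - (p + of_nat i + of_nat j)) (N - j) *
        pochhammer (A + 2 * of_nat j + 1 - (q + of_nat j)) (N - j) *
        pochhammer (A + 2 * of_nat j + 1 - f - (p + of_nat i + of_nat j) - (q + of_nat j)) (N - j)) = D i j"
      by (simp only: D_def)
  qed
  finally show ?thesis .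
qed

text \<open>The factors of \<open>c n j\<close> belonging to \<open>a + 1 - q\<close> and
  \<open>a + 1 + N\<close> cancel against \<open>E i j * D i j\<close>, and \<open>p + i\<close> and
  \<open>h - i\<close> take their place. What is left is a Dougall series in \<open>j\<close> with
  base \<open>a\<close>.\<close>

lemma coefficient_times_inner:
  assumes "j \<le> N"
  shows "c n j * (E i j * D i j) = K i * D i 0
     * vwp a [a + 1 - p, p + of_nat i, h - of_nat i, s + of_nat n, - of_nat n] j"
proof -
  \<comment> \<open>The factors common to \<open>c n j\<close> and the target; \<open>key\<close>
    below compares only the others.\<close>
  define X where "X = (a + 2 * of_nat j) / a * (pochhammer a j / fact j)
     * (pochhammer (a + 1 - p) j / pochhammer p j)
     * (pochhammer (s + of_nat n) j / pochhammer (a + 1 - (s + of_nat n)) j)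
     * (pochhammer (- of_nat n) j / pochhammer (a + 1 - - of_nat n) j)"
  have e: "a + 1 - (a + 1 - x) = x" "a + 1 - (p + of_nat i) = a + 1 - p - of_nat i"
     "a + 1 - (h - of_nat i) = s + 1 + of_nat i" "a + 1 - (a + 1 + of_nat N) = - of_nat N" for x
    by (simp_all add: fhs_defs)
  have cX: "c n j = X * (pochhammer (a + 1 - q) j / pochhammer q j
      * (pochhammer (a + 1 + of_nat N) j / pochhammer (- of_nat N) j))"
    unfolding c_def vwp_def X_def list.map prod_list.Cons prod_list.Nil e by (simp add: mult_ac)
  have vX: "vwp a [a + 1 - p, p + of_nat i, h - of_nat i, s + of_nat n, - of_nat n] j
     = X * (pochhammer (p + of_nat i) j / pochhammer (a + 1 - p - of_nat i) j
      * (pochhammer (h - of_nat i) j / pochhammer (s + 1 + of_nat i) j))"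
    unfolding vwp_def X_def list.map prod_list.Cons prod_list.Nil e by (simp add: mult_ac)
  \<comment> \<open>The symbols of length \<open>N - j\<close> in \<open>D i j\<close> must become
    symbols of length \<open>N\<close> and \<open>j\<close>. The three rules treat an argument that
    moves by \<open>j\<close>, stays fixed, or moves by \<open>2j\<close>.\<close>
  have split: "pochhammer (x + of_nat j) (N - j) = pochhammer x N / pochhammer x j"
    if "x \<notin> \<int>" for x :: 'a
    using pochhammer_product[OF assms, of x] pochhammer_nonzero_if_not_Ints[OF that, of j] by simp
  have split2: "pochhammer x (N - j) = (- 1) ^ j * pochhammer x N / pochhammer (1 - x - of_nat N) j"
    if "x \<notin> \<int>" for x :: 'a
  proof -
    have "1 - x - of_nat N \<notin> \<int>" by (rule not_Ints_shift[OF that]) simp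
    then have "pochhammer (1 - x - of_nat N) j \<noteq> 0" by (rule pochhammer_nonzero_if_not_Ints)
    moreover have "pochhammer x N = pochhammer x (N - j) * pochhammer (x + of_nat (N - j)) j"
      using pochhammer_product'[of x "N - j" j] assms by simp
    moreover have "pochhammer (1 - x - of_nat N) j = (- 1) ^ j * pochhammer (x + of_nat (N - j)) j"
      using pochhammer_reflect[of "x + of_nat (N - j)" j] assms by (simp add: of_nat_diff algebra_simps)
    ultimately show ?thesis
      by (cases "even j") (simp_all add: field_simps)
  qed
  have split3: "pochhammer (x + 2 * of_nat j) (N - j)
      = pochhammer x N * pochhammer (x + of_nat N) j / pochhammer x (2 * j)"
    if "x \<notin> \<int>" for x :: 'a
  proof -
    have "2 * j + (N - j) = N + j" using assms by simp
    from pochhammer_product'[of x "2 * j" "N - j", unfolded this] show ?thesis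
      using pochhammer_product'[of x N j]
       pochhammer_nonzero_if_not_Ints[OF that, of "2 * j"] by simp
  qed
  have headA: "pochhammer (A + 2 * of_nat j + 1) (N - j)
      = pochhammer (A + 1) N * pochhammer (A + 1 + of_nat N) j * A / ((A + 2 * of_nat j) * pochhammer A (2 * j))"
  proof -
    have "A + 1 \<notin> \<int>" by (rule not_Ints_shift[OF generic(1)]) simp
    from split3[OF this] have "pochhammer (A + 2 * of_nat j + 1) (N - j)
        = pochhammer (A + 1) N * pochhammer (A + 1 + of_nat N) j / pochhammer (A + 1) (2 * j)"
      by (simp add: add_ac)
    moreover have "(A + 2 * of_nat j) * pochhammer A (2 * j) = A * pochhammer (A + 1) (2 * j)"
      using pochhammer_shift1[of A "2 * j"] by (simp add: mult.commute)
    moreover have "A \<noteq> 0"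
      using generic(1) by auto
    ultimately show ?thesis
      by simp
  qed
  have notint: "a + 1 - p - of_nat i \<notin> \<int>" "a + 1 - q \<notin> \<int>" "A + 1 - p - of_nat i \<notin> \<int>"
    "A + 1 - q \<notin> \<int>" "A + 1 - p - q - of_nat i \<notin> \<int>" "a + 1 - p - q - of_nat i \<notin> \<int>" "a + 1 \<notin> \<int>"
    "s + 1 + of_nat i \<notin> \<int>" "a' + 1 + of_nat i \<notin> \<int>" "a + 1 + of_nat N \<notin> \<int>"  "A + 1 + of_nat N \<notin> \<int>" "A + 2 * of_nat j \<notin> \<int>"
    by (rule notint_shift(8), simp) (rule notint_shift(9), simp, rule notint_shift(6), simp,
      rule notint_shift(7), simp, rule notint_shift(10), simp, rule notint_shift(11), simp,
      rule notint_shift(2), simp, rule notint_shift(10), simp add: fhs_defs,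
      rule notint_shift(11), simp add: fhs_defs, rule notint_shift(2), simp, rule notint_shift(1), simp,
      rule notint_shift(1), simp)
  have r: "1 - (A + 1 - p - q - of_nat i) - of_nat N = s + 1 + of_nat i"
     "1 - (a + 1 - p - q - of_nat i) - of_nat N = a' + 1 + of_nat i"
    by (simp_all add: fhs_defs)
  have nz: "A \<noteq> 0" "A + 2 * of_nat j \<noteq> 0" "pochhammer (- of_nat N :: 'a) j \<noteq> 0"
    using generic(1) add_of_nat_nonzero_if_not_Ints[OF generic(1), of "2 * j"] assms
    by (auto simp: pochhammer_of_nat_eq_0_iff)
  note nzp = generic(1)[THEN pochhammer_nonzero_if_not_Ints] generic(4)[THEN pochhammer_nonzero_if_not_Ints]
    notint[THEN pochhammer_nonzero_if_not_Ints]
  \<comment> \<open>The bare field identity, with one variable for each Pochhammer symbol;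
    \<open>sg\<close> stands for \<open>(- 1) ^ j\<close>.\<close>
  have cancel: "B / A * PA / Pa * Ki * (H / S') * (Pp / R3) * (Q / R4) * (Nn / AN1)
      * ((AN * AN1 * A / (B * PA)) * (R1N / R1) * (R2N / R2) * (sg * XN / S)
        / ((aN * aN1 / Pa) * (R3N / R3) * (R4N / R4) * (sg * YN / S')))
      * (R2 / Q * (aN1 / Nn))
    = Ki * (AN * R1N * R2N * XN / (aN * R3N * R4N * YN)) * (Pp / R1 * (H / S))"
    if "A \<noteq> 0" "B \<noteq> 0" "PA \<noteq> 0" "Pa \<noteq> 0" "S' \<noteq> 0" "R3 \<noteq> 0" "R4 \<noteq> 0" "Q \<noteq> 0" "Nn \<noteq> 0"
      "AN1 \<noteq> 0" "aN1 \<noteq> 0" "R2 \<noteq> 0" "sg \<noteq> 0"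
    for A B PA Pa Ki H S' Pp R3 Q R4 Nn AN AN1 R1N R1 R2N R2 XN S aN aN1 R3N R4N YN sg :: 'a
    using that by (simp add: mult_ac)
  have D0: "D i 0 = pochhammer (A + 1) N * pochhammer (a + 1 - p - of_nat i) N * pochhammer (a + 1 - q) N
      * pochhammer (A + 1 - p - q - of_nat i) N
    / (pochhammer (a + 1) N * pochhammer (A + 1 - p - of_nat i) N * pochhammer (A + 1 - q) N
      * pochhammer (a + 1 - p - q - of_nat i) N)"
    by (simp add: D_def)
  have key: "E i j * D i j * (pochhammer (a + 1 - q) j / pochhammer q j
      * (pochhammer (a + 1 + of_nat N) j / pochhammer (- of_nat N) j)) = K i * D i 0
      * (pochhammer (p + of_nat i) j / pochhammer (a + 1 - p - of_nat i) j
      * (pochhammer (h - of_nat i) j / pochhammer (s + 1 + of_nat i) j))"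
    unfolding D0
    unfolding D_def headA split[OF notint(1)] split[OF notint(2)] split[OF notint(3)]
      split[OF notint(4)] split2[OF notint(5)] split2[OF notint(6)] split3[OF notint(7)] r E_def
    by (rule cancel) (use nz nzp in simp_all)
  show ?thesis
    using arg_cong[OF key, of "\<lambda>z. X * z"] unfolding cX vX by (simp only: mult_ac)
qed

end

section \<open>Expansion of \<open>V_m\<close> in the functions \<open>\<psi>_i\<close>, and
  biorthogonality\<close>

text \<open>Choose the top coefficient so that the remaining numerator vanishes at the last pole,
  cancel that pole, and induct. Zeros distinct from poles make the choice possible. For
  \<open>m = 0\<close> the truncated \<open>m - 1\<close> is harmless, since \<open>Q\<close> is
  constant.\<close>

lemma partial_fraction_span:
  fixes P R :: "nat \<Rightarrow> 'a::field" and Q :: "'a poly"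
  assumes "degree Q \<le> m" and "\<And>t u. t < m \<Longrightarrow> u < m \<Longrightarrow> P t \<noteq> R u"
  shows "\<exists>v. (\<forall>y. (\<forall>t<m. R t \<noteq> y) \<longrightarrow>
        poly Q y / (\<Prod>t<m. R t - y) = (\<Sum>i\<le>m. v i * (\<Prod>t<i. (P t - y) / (R t - y))))
      \<and> v m = poly Q (R (m - 1)) / (\<Prod>t<m. P t - R (m - 1))"
  using assms
proof (induction m arbitrary: Q)
  case 0
  then obtain x where "Q = [:x:]"
    by (auto elim: degree_eq_zeroE)
  then show ?case
    by (intro exI[of _ "\<lambda>_. x"]) simp
next
  case (Suc m)
  define d where "d = R m"
  define x where "x = poly Q d / (\<Prod>t<Suc m. P t - d)"
  define T where "T = Q - smult x (\<Prod>t<Suc m. [:P t, -1:])"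
  have "poly T d = 0"
  proof -
    have "(\<Prod>t<Suc m. P t - d) \<noteq> 0"
      using Suc.prems(2) by (auto simp: d_def simp del: prod.lessThan_Suc)
    moreover have "poly (\<Prod>t<Suc m. [:P t, -1:]) d = (\<Prod>t<Suc m. P t - d)"
      by (simp add: poly_prod del: prod.lessThan_Suc)
    ultimately show ?thesis
      by (simp add: T_def x_def del: prod.lessThan_Suc)
  qed
  then obtain S where S: "T = [:- d, 1:] * S"
    by (metis poly_eq_0_iff_dvd dvdE)
  have "degree (\<Prod>t<Suc m. [:P t, -1:]) \<le> Suc m"
    using degree_prod_sum_le[of "{..<Suc m}" "\<lambda>t. [:P t, -1:]"] by simp
  then have "degree T \<le> Suc m"
    unfolding T_def using Suc.prems(1) by (intro degree_diff_le order.trans[OF degree_smult_le])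
  have "degree S \<le> m"
  proof (cases "S = 0")
    case False
    then have "degree T = Suc (degree S)"
      unfolding S by (subst degree_mult_eq) auto
    with \<open>degree T \<le> Suc m\<close> show ?thesis by simp
  qed simp
  \<comment> \<open>The sign appears because \<open>T\<close> is divided by \<open>y - d\<close>
    while the denominator contains \<open>R m - y\<close>.\<close>
  then obtain v where v: "\<And>y. (\<forall>t<m. R t \<noteq> y) \<Longrightarrow>
        poly (- S) y / (\<Prod>t<m. R t - y) = (\<Sum>i\<le>m. v i * (\<Prod>t<i. (P t - y) / (R t - y)))"
    using Suc.IH[of "- S"] Suc.prems(2) by fastforce
  show ?case
  proof (intro exI[of _ "v(Suc m := x)"] conjI allI impI)
    fix y assume y: "\<forall>t<Suc m. R t \<noteq> y"
    have Q: "poly Q y = x * (\<Prod>t<Suc m. P t - y) + (R m - y) * poly (- S) y"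
    proof -
      have "poly T y = poly Q y - x * (\<Prod>t<Suc m. P t - y)"
        by (simp add: T_def poly_prod del: prod.lessThan_Suc)
      moreover have "poly T y = (y - d) * poly S y"
        unfolding S by (simp add: algebra_simps)
      ultimately show ?thesis
        by (simp add: d_def algebra_simps del: prod.lessThan_Suc)
    qed
    have "poly Q y / (\<Prod>t<Suc m. R t - y)
        = x * (\<Prod>t<Suc m. (P t - y) / (R t - y)) + poly (- S) y / (\<Prod>t<m. R t - y)"
    proof -
      have "R m - y \<noteq> 0" using y by simp
      then show ?thesis
        unfolding Q prod_dividef add_divide_distrib by simp
    qed
    also have "poly (- S) y / (\<Prod>t<m. R t - y) = (\<Sum>i\<le>m. v i * (\<Prod>t<i. (P t - y) / (R t - y)))"
      using y by (intro v) simp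
    finally show "poly Q y / (\<Prod>t<Suc m. R t - y)
        = (\<Sum>i\<le>Suc m. (v(Suc m := x)) i * (\<Prod>t<i. (P t - y) / (R t - y)))"
      by simp
  qed (simp add: x_def d_def)
qed

text \<open>Factor by factor, the product depends on \<open>z\<close> only through
  \<open>z * (z + A)\<close>. This makes \<open>\<psi>_i\<close> and the terms of \<open>V_m\<close>
  rational functions of one variable with explicit zeros and poles.\<close>

lemma pochhammer_pair_prod:
  fixes x z A :: "'a::comm_ring_1"
  shows "pochhammer (x + z) i * pochhammer (x - A - z) i
    = (\<Prod>t<i. (x + of_nat t) * (x + of_nat t - A) - z * (z + A))"
  unfolding pochhammer_prod prod.distrib[symmetric] atLeast0LessThan
  by (intro prod.cong) (simp_all add: algebra_simps)

context generic_parameters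
begin

definition Ux where "Ux n k = (\<Sum>j\<le>n. c n j * \<phi> j k)"

text \<open>The formula for \<open>Ux\<close> with \<open>a'\<close> in place of \<open>a\<close>,
  written out.\<close>

definition Vx where
  "Vx m k = (\<Sum>i\<le>m. vwp a' [a' + 1 - p, a' + 1 - q, a' + 1 + of_nat N, s + of_nat m, - of_nat m] i
     * (pochhammer (- of_nat k) i * pochhammer (A + of_nat k) i
        / (pochhammer (a' + 1 + of_nat k) i * pochhammer (a' + 1 - A - of_nat k) i)))"

definition G where
  "G n i = pochhammer (a + 1) n * pochhammer (- of_nat i) n * pochhammer (p - h + of_nat i) n
      * pochhammer (a + 1 - p - h) n
    / (pochhammer p n * pochhammer (a + 1 - p - of_nat i) n * pochhammer (s + 1 + of_nat i) n
      * pochhammer (- h) n)"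

text \<open>After the inner sum over \<open>k\<close>, Dougall's formula applies a second time, to
  the sum over \<open>j\<close> with base \<open>a\<close>. Two of its parameters are
  \<open>a + 1 - p\<close> and \<open>p + i\<close>, whence the factor \<open>(-i)_n\<close> in
  \<open>G n i\<close>.\<close>

lemma sum_Ux_\<psi>:
  assumes "n \<le> N"
  shows "(\<Sum>k\<le>N. w k * Ux n k * \<psi> i k) = K i * D i 0 * G n i"
proof -
  have "(\<Sum>k\<le>N. w k * Ux n k * \<psi> i k) = (\<Sum>j\<le>n. c n j * (\<Sum>k\<le>N. w k * \<phi> j k * \<psi> i k))"
    unfolding Ux_def sum_distrib_left sum_distrib_right
    by (subst sum.swap) (simp add: mult_ac)
  also have "\<dots> = (\<Sum>j\<le>n. K i * D i 0
      * vwp a [a + 1 - p, p + of_nat i, h - of_nat i, s + of_nat n, - of_nat n] j)"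
    using assms by (intro sum.cong refl) (simp add: inner_sum coefficient_times_inner)
  also have "\<dots> = K i * D i 0 * (\<Sum>j\<le>n. vwp a [a + 1 - p, p + of_nat i, h - of_nat i,
      2 * a + 1 + of_nat n - (a + 1 - p) - (p + of_nat i) - (h - of_nat i), - of_nat n] j)"
  proof -
    have "2 * a + 1 + of_nat n - (a + 1 - p) - (p + of_nat i) - (h - of_nat i) = s + of_nat n"
      by (simp add: fhs_defs)
    then show ?thesis by (simp only: sum_distrib_left)
  qed
  also have "(\<Sum>j\<le>n. vwp a [a + 1 - p, p + of_nat i, h - of_nat i,
      2 * a + 1 + of_nat n - (a + 1 - p) - (p + of_nat i) - (h - of_nat i), - of_nat n] j) = G n i"
  proof (subst dougall_7F6)
    show "a \<notin> \<int>" by (rule generic)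
    show "a - (a + 1 - p) \<notin> \<int>" by (rule notint_shift(3)) simp
    show "a - (p + of_nat i) \<notin> \<int>" by (rule notint_shift(8)) simp
    show "a - (h - of_nat i) \<notin> \<int>" by (rule notint_shift(10)) (simp add: fhs_defs)
    show "a + 1 - p + (p + of_nat i) + (h - of_nat i) - a \<notin> \<int>"
      by (rule notint_shift(12)) (simp add: fhs_defs)
    show "2 * a - (a + 1 - p) - (p + of_nat i) - (h - of_nat i) \<notin> \<int>"
      by (rule notint_shift(10)) (simp add: fhs_defs)
    have "a + 1 - (a + 1 - p) - (p + of_nat i) = - of_nat i"
      "a + 1 - (a + 1 - p) - (h - of_nat i) = p - h + of_nat i"
      "a + 1 - (p + of_nat i) - (h - of_nat i) = a + 1 - p - h"
      "a + 1 - (a + 1 - p) = p" "a + 1 - (p + of_nat i) = a + 1 - p - of_nat i"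
      "a + 1 - (h - of_nat i) = s + 1 + of_nat i"
      "a + 1 - (a + 1 - p) - (p + of_nat i) - (h - of_nat i) = - h"
      by (simp_all add: fhs_defs)
    then show "pochhammer (a + 1) n * pochhammer (a + 1 - (a + 1 - p) - (p + of_nat i)) n *
      pochhammer (a + 1 - (a + 1 - p) - (h - of_nat i)) n *
      pochhammer (a + 1 - (p + of_nat i) - (h - of_nat i)) n /
      (pochhammer (a + 1 - (a + 1 - p)) n * pochhammer (a + 1 - (p + of_nat i)) n *
       pochhammer (a + 1 - (h - of_nat i)) n *
       pochhammer (a + 1 - (a + 1 - p) - (p + of_nat i) - (h - of_nat i)) n) = G n i"
      by (simp only: G_def)
  qed
  finally show ?thesis .
qed

text \<open>The second factor is the quotient of the numerators of the \<open>m\<close>-th term of \<open>Vx m\<close> and of \<open>\<psi> m\<close> at the last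
  pole \<open>k = - a' - m\<close>.\<close>
definition lead where
  "lead m = vwp a' [a' + 1 - p, a' + 1 - q, a' + 1 + of_nat N, s + of_nat m, - of_nat m] m
     * (pochhammer (a' + of_nat m) m * pochhammer (h - of_nat m) m
       / (pochhammer (p - a' - of_nat m) m * pochhammer (p - h + of_nat m) m))"

text \<open>Over the common denominator of its \<open>m\<close> poles, \<open>V_m\<close> has a
  numerator of degree at most \<open>m\<close> in \<open>y = k * (k + A)\<close>, so
  \<open>partial_fraction_span\<close> applies. Genericity separates the poles from the zeros of
  \<open>\<psi>_i\<close> and from the points of summation.\<close>

lemma Vx_expansion:
  "\<exists>v. (\<forall>k. Vx m k = (\<Sum>i\<le>m. v i * \<psi> i k)) \<and> v m = lead m"
proof -
  define C where "C = vwp a' [a' + 1 - p, a' + 1 - q, a' + 1 + of_nat N, s + of_nat m, - of_nat m]"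
  define node where "node = (\<lambda>x t. (x + of_nat t) * (x + of_nat t - A))"
  define Q where "Q = (\<Sum>i\<le>m. smult (C i) ((\<Prod>t<i. [:node A t, -1:]) * (\<Prod>t\<in>{i..<m}. [:node (a' + 1) t, -1:])))"
  have pair: "pochhammer (x + z) i * pochhammer (x - A - z) i = (\<Prod>t<i. node x t - z * (z + A))" for x z i
    unfolding node_def by (rule pochhammer_pair_prod)
  have \<psi>: "\<psi> i k = (\<Prod>t<i. (node p t - of_nat k * (of_nat k + A)) / (node (a' + 1) t - of_nat k * (of_nat k + A)))"
    for i k
  proof -
    have e: "1 - h - of_nat k = a' + 1 - A - of_nat k" by (simp add: fhs_defs)
    show ?thesis
      unfolding \<psi>_def prod_dividef pair[symmetric] e ..
  qed
  have neq: "node (a' + 1) t \<noteq> of_nat k * (of_nat k + A)" for t k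
  proof -
    have "a' + 1 + of_nat t + of_nat k \<notin> \<int>"
      by (rule notint_shift(11)) (simp add: fhs_defs)
    moreover have "a' + 1 + of_nat t - A - of_nat k \<notin> \<int>"
      by (rule notint_shift(12)) (simp add: fhs_defs)
    ultimately have "(a' + 1 + of_nat t + of_nat k) * (a' + 1 + of_nat t - A - of_nat k) \<noteq> 0"
      by (metis Ints_0 mult_eq_0_iff)
    moreover have "(a' + 1 + of_nat t + of_nat k) * (a' + 1 + of_nat t - A - of_nat k) = node (a' + 1) t - of_nat k * (of_nat k + A)"
      by (simp add: node_def algebra_simps)
    ultimately show ?thesis by auto
  qed
  have neq': "node p t \<noteq> node (a' + 1) u" for t u
  proof -
    have "p + of_nat t - (a' + 1 + of_nat u) \<notin> \<int>"
      by (rule notint_shift(9)) (simp add: fhs_defs)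
    moreover have "p + of_nat t + (a' + 1 + of_nat u) - A \<notin> \<int>"
      by (rule notint_shift(13)) (simp add: fhs_defs)
    ultimately have "(p + of_nat t - (a' + 1 + of_nat u)) * (p + of_nat t + (a' + 1 + of_nat u) - A) \<noteq> 0"
      by (metis Ints_0 mult_eq_0_iff)
    moreover have "(p + of_nat t - (a' + 1 + of_nat u)) * (p + of_nat t + (a' + 1 + of_nat u) - A) = node p t - node (a' + 1) u"
      by (simp add: node_def algebra_simps)
    ultimately show ?thesis by auto
  qed
  have Vx: "Vx m k = poly Q y / (\<Prod>t<m. node (a' + 1) t - y)" if y: "y = of_nat k * (of_nat k + A)" for k y
  proof -
    have "pochhammer (- of_nat k) i * pochhammer (A + of_nat k) i
        / (pochhammer (a' + 1 + of_nat k) i * pochhammer (a' + 1 - A - of_nat k) i)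
      = (\<Prod>t<i. node A t - y) * (\<Prod>t\<in>{i..<m}. node (a' + 1) t - y) / (\<Prod>t<m. node (a' + 1) t - y)"
      if "i \<le> m" for i
    proof -
      have *: "(\<Prod>t<m. node (a' + 1) t - y)
          = (\<Prod>t<i. node (a' + 1) t - y) * (\<Prod>t\<in>{i..<m}. node (a' + 1) t - y)"
        using prod.atLeastLessThan_concat[of 0 i m "\<lambda>t. node (a' + 1) t - y"] that
        by (simp add: atLeast0LessThan)
      have "(\<Prod>t\<in>{i..<m}. node (a' + 1) t - y) \<noteq> 0"
        using neq by (simp add: y)
      moreover have "pochhammer (- of_nat k) i * pochhammer (A + of_nat k) i = (\<Prod>t<i. node A t - y)"
        using pair[of A "of_nat k" i] by (simp add: y mult.commute)
      moreover have "pochhammer (a' + 1 + of_nat k) i * pochhammer (a' + 1 - A - of_nat k) i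
          = (\<Prod>t<i. node (a' + 1) t - y)"
        using pair[of "a' + 1" "of_nat k" i] by (simp only: y)
      ultimately show ?thesis
        unfolding * by simp
    qed
    then show ?thesis
      unfolding Vx_def C_def[symmetric] Q_def poly_sum sum_divide_distrib
      by (intro sum.cong refl) (simp add: poly_prod)
  qed
  have "degree Q \<le> m"
    unfolding Q_def
  proof (intro degree_sum_le)
    fix i assume "i \<in> {..m}"
    have "degree ((\<Prod>t<i. [:node A t, -1:]) * (\<Prod>t\<in>{i..<m}. [:node (a' + 1) t, -1:])) \<le> i + (m - i)"
      using degree_prod_sum_le[of "{..<i}" "\<lambda>t. [:node A t, -1:]"]
        degree_prod_sum_le[of "{i..<m}" "\<lambda>t. [:node (a' + 1) t, -1:]"]
      by (intro order.trans[OF degree_mult_le] add_mono) simp_all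
    then show "degree (smult (C i) ((\<Prod>t<i. [:node A t, -1:]) * (\<Prod>t\<in>{i..<m}. [:node (a' + 1) t, -1:]))) \<le> m"
      using \<open>i \<in> {..m}\<close> by (intro order.trans[OF degree_smult_le]) simp
  qed simp
  from partial_fraction_span[OF this, of "node p" "node (a' + 1)"] neq'
  obtain v where v: "\<And>y. (\<forall>t<m. node (a' + 1) t \<noteq> y) \<Longrightarrow>
        poly Q y / (\<Prod>t<m. node (a' + 1) t - y)
          = (\<Sum>i\<le>m. v i * (\<Prod>t<i. (node p t - y) / (node (a' + 1) t - y)))"
      and vm: "v m = poly Q (node (a' + 1) (m - 1)) / (\<Prod>t<m. node p t - node (a' + 1) (m - 1))"
    by blast
  have "Vx m k = (\<Sum>i\<le>m. v i * \<psi> i k)" for k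
    unfolding Vx[OF refl] \<psi> using neq by (intro v) auto
  moreover have "v m = lead m"
  proof -
    \<comment> \<open>The last pole in the variable \<open>k\<close>: for \<open>m > 0\<close> it
      satisfies \<open>y = z * (z + A)\<close>, while for \<open>m = 0\<close> all products over
      \<open>t < m\<close> are empty.\<close>
    define z where "z = - a' - of_nat m"
    define y where "y = node (a' + 1) (m - 1)"
    have "poly Q y = (\<Sum>i\<le>m. C i * ((\<Prod>t<i. node A t - y) * (\<Prod>t\<in>{i..<m}. node (a' + 1) t - y)))"
      by (simp add: Q_def poly_sum poly_prod)
    \<comment> \<open>For \<open>i < m\<close> the second product contains the factor with
      \<open>t = m - 1\<close>, which vanishes at \<open>y\<close>.\<close>
    also have "\<dots> = (\<Sum>i\<in>{m}. C i * ((\<Prod>t<i. node A t - y) * (\<Prod>t\<in>{i..<m}. node (a' + 1) t - y)))"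
    proof (rule sum.mono_neutral_right)
      show "\<forall>i\<in>{..m} - {m}. C i * ((\<Prod>t<i. node A t - y) * (\<Prod>t\<in>{i..<m}. node (a' + 1) t - y)) = 0"
        by (auto simp: y_def intro!: bexI[of _ "m - 1"])
    qed auto
    finally have Qy: "poly Q y = C m * (\<Prod>t<m. node A t - y)" by simp
    have yz: "(\<Prod>t<m. node x t - y) = (\<Prod>t<m. node x t - z * (z + A))" for x
    proof (cases m)
      case (Suc m')
      then have "y = z * (z + A)"
        by (simp add: y_def z_def node_def algebra_simps)
      then show ?thesis by simp
    qed simp
    have e: "A + z = h - of_nat m" "A - A - z = a' + of_nat m" "p + z = p - a' - of_nat m"
        "p - A - z = p - h + of_nat m"
      by (simp_all add: z_def fhs_defs)
    show ?thesis
      unfolding vm y_def[symmetric] Qy yz pair[symmetric] e lead_def C_def by (simp add: mult_ac)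
  qed
  ultimately show ?thesis by blast
qed

text \<open>Only indices \<open>i \<le> m \<le> n\<close> occur, and \<open>G n i\<close> vanishes
  for \<open>i < n\<close>. So at most the term \<open>i = m = n\<close> survives, with coefficient
  \<open>lead n\<close>.\<close>

lemma biorthogonal_le:
  assumes "m \<le> n" "n \<le> N"
  shows "(\<Sum>k\<le>N. w k * Ux n k * Vx m k) = (if n = m then lead n * (K n * D n 0 * G n n) else 0)"
proof -
  obtain v where v: "\<And>k. Vx m k = (\<Sum>i\<le>m. v i * \<psi> i k)" and vm: "v m = lead m"
    using Vx_expansion by blast
  have "(\<Sum>k\<le>N. w k * Ux n k * Vx m k) = (\<Sum>i\<le>m. v i * (\<Sum>k\<le>N. w k * Ux n k * \<psi> i k))"
    unfolding v sum_distrib_left sum_distrib_right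
    by (subst sum.swap) (simp add: mult_ac)
  also have "\<dots> = (\<Sum>i\<le>m. v i * (K i * D i 0 * G n i))"
    using assms by (simp add: sum_Ux_\<psi>)
  also have "\<dots> = (\<Sum>i\<le>m. if i = n then v i * (K i * D i 0 * G n i) else 0)"
    using assms by (intro sum.cong refl) (auto simp: G_def pochhammer_of_nat_eq_0_iff)
  finally show ?thesis
    using assms vm by auto
qed

lemma swap_parameters: "generic_parameters A a' p q"
proof
  show "A \<notin> \<int>" "p \<notin> \<int>" "q \<notin> \<int>" "A - p \<notin> \<int>" "A - q \<notin> \<int>" "p + q - A \<notin> \<int>" by (rule generic)+
  show "a' \<notin> \<int>" by (rule notint_shift(11)) (simp add: fhs_defs)
  show "A - a' \<notin> \<int>" by (rule notint_shift(12)) (simp add: fhs_defs)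
  show "a' - p \<notin> \<int>" by (rule notint_shift(9)) (simp add: fhs_defs)
  show "a' - q \<notin> \<int>" by (rule notint_shift(8)) (simp add: fhs_defs)
  show "p + q - a' \<notin> \<int>" by (rule notint_shift(2)) (simp add: fhs_defs)
  show "A + a' - p - q \<notin> \<int>" by (rule notint_shift(5)) (simp add: fhs_defs)
  show "2 * p + q - A - a' \<notin> \<int>" by (rule notint_shift(15)) (simp add: fhs_defs)
  show "p + 2 * q - A - a' \<notin> \<int>" by (rule notint_shift(16)) (simp add: fhs_defs)
  show "A - a' - p \<notin> \<int>" by (rule notint_shift(13)) (simp add: fhs_defs)
  show "A - a' - q \<notin> \<int>" by (rule notint_shift(14)) (simp add: fhs_defs)
qed

text \<open>For \<open>m > n\<close> the locale is interpreted at \<open>a'\<close>. This exchanges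
  \<open>f\<close> with \<open>h\<close> and \<open>Ux\<close> with \<open>Vx\<close> and leaves the
  weight unchanged, so the previous case applies.\<close>

lemma biorthogonal:
  assumes "m \<le> N" "n \<le> N"
  shows "(\<Sum>k\<le>N. w k * Ux n k * Vx m k) = (if n = m then lead n * (K n * D n 0 * G n n) else 0)"
proof (cases "m \<le> n")
  case True
  then show ?thesis using assms by (simp add: biorthogonal_le)
next
  case False
  interpret swap: generic_parameters A a' p q N by (rule swap_parameters)
  have a: "swap.a' = a" and hf: "swap.f = h" "swap.h = f"
    unfolding swap.fhs_defs by (simp_all add: fhs_defs)
  have w: "swap.w k = w k" for k
    by (simp add: swap.w_def w_def hf vwp_def mult_ac)
  have Ux: "swap.Ux m k = Vx m k" for k
    by (simp add: swap.Ux_def Vx_def swap.c_def swap.\<phi>_def)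
  have Vx: "swap.Vx n k = Ux n k" for k
    by (simp add: swap.Vx_def Ux_def c_def \<phi>_def a)
  show ?thesis
    using swap.biorthogonal_le[of n m] False assms
    by (simp add: w Ux Vx mult_ac)
qed

end

section \<open>Closed form of the squared norm\<close>

text \<open>Both \<open>(x - n)_n (x)_N\<close> and \<open>(x - n)_N (x - n + N)_n\<close> equal
  \<open>(x - n)_{n + N}\<close>; reflection then reverses the symbols of length
  \<open>n\<close>.\<close>

lemma pochhammer_sub_ratio:
  fixes x :: "'a::field_char_0"
  assumes "x \<notin> \<int>"
  shows "pochhammer (x - of_nat n) N
    = pochhammer x N * pochhammer (1 - x) n / pochhammer (1 - x - of_nat N) n"
proof -
  have "1 - x - of_nat N \<notin> \<int>" by (rule not_Ints_shift[OF assms]) simp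
  then have nz: "pochhammer (1 - x - of_nat N) n \<noteq> 0" by (rule pochhammer_nonzero_if_not_Ints)
  have 1: "pochhammer (1 - x) n = (- 1) ^ n * pochhammer (x - of_nat n) n"
    using pochhammer_reflect[of "x - of_nat n" n] by simp
  have 2: "pochhammer (1 - x - of_nat N) n = (- 1) ^ n * pochhammer (x - of_nat n + of_nat N) n"
    using pochhammer_reflect[of "x - of_nat n + of_nat N" n] by (simp add: algebra_simps)
  have 3: "pochhammer (x - of_nat n) n * pochhammer x N
      = pochhammer (x - of_nat n) N * pochhammer (x - of_nat n + of_nat N) n"
    using pochhammer_product'[of "x - of_nat n" n N] pochhammer_product'[of "x - of_nat n" N n]
    by (simp add: add.commute)
  have "pochhammer (x - of_nat n) N * pochhammer (1 - x - of_nat N) n = pochhammer x N * pochhammer (1 - x) n"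
    unfolding 1 2 using arg_cong[OF 3, of "\<lambda>z. (- 1) ^ n * z"] by (simp only: mult_ac)
  then show ?thesis
    using nz by (simp add: eq_divide_eq)
qed

context generic_parameters
begin

text \<open>The prefactor is the part of the weight that does not depend on \<open>k\<close>; the
  right-hand side is \<open>C_norm\<close> expressed in \<open>A\<close>, \<open>a\<close>,
  \<open>p\<close>, \<open>q\<close>.\<close>

lemma norm_closed_form:
  "pochhammer (a + 1) N * pochhammer (A + 1 - p) N * pochhammer (A + 1 - q) N * pochhammer (a + 1 - p - q) N
    / (pochhammer (A + 1) N * pochhammer (a + 1 - p) N * pochhammer (a + 1 - q) N * pochhammer (A + 1 - p - q) N)
    * (lead n * (K n * D n 0 * G n n))
  = fact n * pochhammer (p - A - of_nat N) n * pochhammer (q - A - of_nat N) n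
      / (pochhammer (- of_nat N) n * pochhammer (- h) n * pochhammer p n)
    * (pochhammer (p + q - A) n * pochhammer (a' + 1) n * pochhammer (a + 1) n
      / (pochhammer q n * pochhammer (a - A) n * pochhammer (s + 1) n))
    * ((s + of_nat n) / (s + 2 * of_nat n))"
proof -
  define sg where "sg = ((- 1) ^ n :: 'a)"
  have sg: "sg \<noteq> 0" by (simp add: sg_def)
  have notint: "a \<notin> \<int>" "p \<notin> \<int>" "q \<notin> \<int>" "a + 1 \<notin> \<int>" "A + 1 \<notin> \<int>" "A + 1 - p \<notin> \<int>" "A + 1 - q \<notin> \<int>"
    "a + 1 - p - q \<notin> \<int>" "A + 1 - p - q \<notin> \<int>" "a + 1 - p \<notin> \<int>" "a + 1 - q \<notin> \<int>" "a' \<notin> \<int>"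
    "a' + of_nat n \<notin> \<int>" "a' + 1 \<notin> \<int>" "a' + 1 + of_nat n \<notin> \<int>" "a' + 1 - p \<notin> \<int>"
    "p - a - of_nat N \<notin> \<int>" "p + q - a \<notin> \<int>" "h - of_nat n \<notin> \<int>" "p - h + of_nat n \<notin> \<int>"
    "p - A \<notin> \<int>" "p - A - of_nat N \<notin> \<int>" "p - a \<notin> \<int>" "s + 1 \<notin> \<int>" "s + 1 + of_nat n \<notin> \<int>"
    by (rule generic, rule generic, rule generic, rule notint_shift(2), simp, rule notint_shift(1), simp,
      rule notint_shift(6), simp, rule notint_shift(7), simp, rule notint_shift(11), simp,
      rule notint_shift(10), simp, rule notint_shift(8), simp, rule notint_shift(9), simp,
      rule notint_shift(11), simp add: fhs_defs, rule notint_shift(11), simp add: fhs_defs,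
      rule notint_shift(11), simp add: fhs_defs, rule notint_shift(11), simp add: fhs_defs,
      rule notint_shift(9), simp add: fhs_defs, rule notint_shift(8), simp, rule generic,
      rule notint_shift(12), simp add: fhs_defs, rule notint_shift(13), simp add: fhs_defs,
      rule notint_shift(6), simp, rule notint_shift(6), simp, rule notint_shift(8), simp,
      rule notint_shift(10), simp add: fhs_defs, rule notint_shift(10), simp add: fhs_defs)
  note nzp = notint[THEN pochhammer_nonzero_if_not_Ints]
  have s2n: "s + 2 * of_nat n \<noteq> 0" "s + of_nat n + of_nat n \<noteq> 0"
  proof -
    have "s \<notin> \<int>" by (rule notint_shift(10)) (simp add: fhs_defs)
    from add_of_nat_nonzero_if_not_Ints[OF this, of "2 * n"]
    show "s + 2 * of_nat n \<noteq> 0" "s + of_nat n + of_nat n \<noteq> 0" by (simp_all add: algebra_simps)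
  qed
  have a'2n: "a' + 2 * of_nat n \<noteq> 0" "a' \<noteq> 0"
    using add_of_nat_nonzero_if_not_Ints[OF notint(12), of "2 * n"] notint(12) by auto
  \<comment> \<open>The origin of the factor \<open>(s + n) / (s + 2n)\<close> in the norm:
    \<open>(s + n)_n\<close> stems from the last coefficient of \<open>V_n\<close>,
    \<open>(s + 1 + n)_n\<close> from \<open>G n n\<close>.\<close>
  have sn: "pochhammer (s + of_nat n) n
      = (s + of_nat n) * pochhammer (s + 1 + of_nat n) n / (s + 2 * of_nat n)"
    using pochhammer_shift1[of "s + of_nat n" n] s2n(1)
    by (simp add: eq_divide_eq add_ac)
  \<comment> \<open>In this form the very-well-poised factor \<open>(a' + 2n) / a'\<close> of
    \<open>lead n\<close> cancels.\<close>
  have bn: "pochhammer a' n = a' * pochhammer (a' + 1) n * pochhammer (a' + 1 + of_nat n) n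
      / ((a' + 2 * of_nat n) * pochhammer (a' + of_nat n) n)"
  proof -
    have "pochhammer a' n * pochhammer (a' + of_nat n) n * (a' + 2 * of_nat n)
        = a' * (pochhammer (a' + 1) n * pochhammer (a' + 1 + of_nat n) n)"
      using pochhammer_shift1[of a' "n + n"] unfolding pochhammer_product' by simp
    then show ?thesis
      using nzp(13)[of n] a'2n by (simp add: eq_divide_eq mult_ac)
  qed
  have reflect: "pochhammer (A + 1 - p - of_nat n) n = sg * pochhammer (p - A) n"
    "pochhammer (a + 1 - p - of_nat n) n = sg * pochhammer (p - a) n"
    "pochhammer (p - a' - of_nat n) n = sg * pochhammer (a' + 1 - p) n"
    "pochhammer (a' + 1 - (s + of_nat n)) n = sg * pochhammer (a - A) n"
    "pochhammer (- of_nat n) n = sg * fact n"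
    using pochhammer_reflect[of "p - A" n] pochhammer_reflect[of "p - a" n]
      pochhammer_reflect[of "a' + 1 - p" n] pochhammer_reflect[of "a - A" n]
      pochhammer_same[of n, where 'a='a]
    by (simp_all add: sg_def fhs_defs algebra_simps)
  have ratio: "pochhammer (a + 1 - p - of_nat n) N
      = pochhammer (a + 1 - p) N * pochhammer (p - a) n / pochhammer (p - a - of_nat N) n"
    "pochhammer (A + 1 - p - of_nat n) N
      = pochhammer (A + 1 - p) N * pochhammer (p - A) n / pochhammer (p - A - of_nat N) n"
    "pochhammer (A + 1 - p - q - of_nat n) N
      = pochhammer (A + 1 - p - q) N * pochhammer (p + q - A) n / pochhammer (s + 1) n"
    "pochhammer (a + 1 - p - q - of_nat n) N
      = pochhammer (a + 1 - p - q) N * pochhammer (p + q - a) n / pochhammer (a' + 1) n"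
  proof -
    have e: "1 - (a + 1 - p) = p - a" "1 - (A + 1 - p) = p - A" "1 - (A + 1 - p - q) = p + q - A"
      "1 - (a + 1 - p - q) = p + q - a" "p + q - A - of_nat N = s + 1" "p + q - a - of_nat N = a' + 1"
      by (simp_all add: fhs_defs)
    note r = pochhammer_sub_ratio[of _ n N]
    show "pochhammer (a + 1 - p - of_nat n) N
      = pochhammer (a + 1 - p) N * pochhammer (p - a) n / pochhammer (p - a - of_nat N) n"
      using r[OF notint(10)] unfolding e .
    show "pochhammer (A + 1 - p - of_nat n) N
      = pochhammer (A + 1 - p) N * pochhammer (p - A) n / pochhammer (p - A - of_nat N) n"
      using r[OF notint(6)] unfolding e .
    show "pochhammer (A + 1 - p - q - of_nat n) N
      = pochhammer (A + 1 - p - q) N * pochhammer (p + q - A) n / pochhammer (s + 1) n"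
      using r[OF notint(9)] unfolding e .
    show "pochhammer (a + 1 - p - q - of_nat n) N
      = pochhammer (a + 1 - p - q) N * pochhammer (p + q - a) n / pochhammer (a' + 1) n"
      using r[OF notint(8)] unfolding e .
  qed
  have e: "a' + 1 - (a' + 1 - x) = x" "a' + 1 - (a' + 1 + of_nat N) = - of_nat N"
    "a' + 1 - - of_nat n = a' + 1 + of_nat n" "a' + 1 - q = p - a - of_nat N"
    "a' + 1 + of_nat N = p + q - a" "a + 1 - p - h = q - A - of_nat N" for x
    by (simp_all add: fhs_defs)
  have e2: "a' + 1 - (p - a - of_nat N) = q" "a' + 1 - (p + q - a) = - of_nat N"
    by (simp_all add: fhs_defs)
  have D0: "D n 0 = pochhammer (A + 1) N * pochhammer (a + 1 - p - of_nat n) N * pochhammer (a + 1 - q) N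
      * pochhammer (A + 1 - p - q - of_nat n) N
    / (pochhammer (a + 1) N * pochhammer (A + 1 - p - of_nat n) N * pochhammer (A + 1 - q) N
      * pochhammer (a + 1 - p - q - of_nat n) N)"
    by (simp add: D_def)
  \<comment> \<open>Again the bare field identity; \<open>sg\<close> is \<open>(- 1) ^ n\<close>,
    \<open>fn\<close> is \<open>n!\<close>, and \<open>b0\<close>, \<open>b2\<close> are
    \<open>a'\<close> and \<open>a' + 2n\<close>.\<close>
  have cancel: "a1N * Ap * Aq * apq / (A1N * ap * aq * Apq)
    * ((b2 / b0 * ((b0 * b1 * b1n / (b2 * bnn)) / fn)
          * (u1 / pp * (u2 / qq * (v / Nn * ((s1 * s1n / s2 / (sg * aA)) * (sg * fn / b1n)))))
        * (bnn * hn / (sg * u1 * ph)))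
      * (pp * (sg * pA) / (hn * b1)
        * (A1N * (ap * pa / u2) * aq * (Apq * pqA / sp) / (a1N * (Ap * pA / pAN) * Aq * (apq * v / b1)))
        * (an * (sg * fn) * ph * qAN / (pp * (sg * pa) * s1n * mh))))
    = fn * pAN * qAN / (Nn * mh * pp) * (pqA * b1 * an / (qq * aA * sp)) * (s1 / s2)"
    if "a1N \<noteq> 0" "Ap \<noteq> 0" "Aq \<noteq> 0" "apq \<noteq> 0" "A1N \<noteq> 0" "ap \<noteq> 0" "aq \<noteq> 0" "Apq \<noteq> 0"
      "b2 \<noteq> 0" "b0 \<noteq> 0" "b1 \<noteq> 0" "b1n \<noteq> 0" "bnn \<noteq> 0" "fn \<noteq> 0" "u1 \<noteq> 0" "u2 \<noteq> 0" "v \<noteq> 0"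
      "s1n \<noteq> 0" "sg \<noteq> 0" "hn \<noteq> 0" "ph \<noteq> 0" "pp \<noteq> 0" "pA \<noteq> 0" "pa \<noteq> 0"
    for a1N Ap Aq apq A1N ap aq Apq b2 b0 b1 b1n bnn fn u1 pp u2 qq v Nn s1 s1n s2 sg aA hn ph pA pa
      pqA sp pAN an qAN mh :: 'a
    using that by (simp add: mult_ac)
  show ?thesis
    unfolding lead_def vwp_def list.map prod_list.Cons prod_list.Nil mult_1_right K_def D0 G_def
      e e2 reflect ratio bn sn
    by (rule cancel) (use nzp sg a'2n in simp_all)
qed

end

section \<open>Translation into the original parameters\<close>

lemma vwp_head:
  fixes A :: "'a::field_char_0"
  assumes "A \<notin> \<int>"
  shows "pochhammer (1 + A / 2) k / pochhammer (A / 2) k = (A + 2 * of_nat k) / A"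
proof -
  define x where "x = A / 2"
  have A: "A = 2 * x" by (simp add: x_def)
  have "x \<notin> \<int>"
  proof
    assume "x \<in> \<int>"
    then have "2 * x \<in> \<int>" by (intro Ints_mult) auto
    with assms A show False by simp
  qed
  then have "pochhammer x k \<noteq> 0" "x \<noteq> 0"
    using pochhammer_nonzero_if_not_Ints by auto
  moreover have "x * pochhammer (1 + x) k = pochhammer x k * (x + of_nat k)"
    using pochhammer_shift1[of x k] by (simp add: add.commute)
  ultimately have "pochhammer (1 + x) k / pochhammer x k = (x + of_nat k) / x"
    by (simp add: frac_eq_eq mult_ac)
  also have "\<dots> = 2 * (x + of_nat k) / (2 * x)"
    by (simp only: mult_divide_mult_cancel_left_if) simp
  also have "\<dots> = (A + 2 * of_nat k) / A"
    by (simp only: A distrib_left)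
  finally show ?thesis by (simp only: x_def)
qed

text \<open>With \<open>A = \<mu> + 2 * b\<close>, \<open>p = a - d + 1\<close> and
  \<open>q = a - e + 1\<close>, every parameter list becomes the one used in the locale, and
  \<open>biorthogonal\<close> with \<open>norm_closed_form\<close> gives the claim.\<close>

lemma corollary4p7_generic:
  fixes N n m :: nat and a b d e \<mu> :: complex
  assumes nm: "n \<le> N" "m \<le> N"
    and gen: "generic_parameters (\<mu> + 2 * b) a (a - d + 1) (a - e + 1)"
  shows "(\<Sum>k=0..N. U_par N a b d e \<mu> n (b + of_nat k) * V_par N a b d e \<mu> m (b + of_nat k)
            * r_weight N a b d e \<mu> k)
         = C_norm N a b d e \<mu> n * (if n = m then 1 else 0)"
proof -
  define A where "A = \<mu> + 2 * b"
  define p where "p = a - d + 1"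
  define q where "q = a - e + 1"
  interpret generic_parameters A a p q N
    using gen by (simp add: A_def p_def q_def)
  have par: "\<mu> = A - 2 * b" "d = a + 1 - p" "e = a + 1 - q"
    by (simp_all add: A_def p_def q_def)
  have a': "a' \<notin> \<int>" by (rule notint_shift(11)) (simp add: fhs_defs)
  define cst where "cst = pochhammer (a + 1) N * pochhammer (A + 1 - p) N * pochhammer (A + 1 - q) N
    * pochhammer (a + 1 - p - q) N
    / (pochhammer (A + 1) N * pochhammer (a + 1 - p) N * pochhammer (a + 1 - q) N * pochhammer (A + 1 - p - q) N)"
  have UU: "U_par N a b d e \<mu> n (b + of_nat k) = Ux n k" for k
  proof -
    have up: "U_upper N a b d e \<mu> n (b + of_nat k) = [a, 1 + a / 2, - of_nat k, A + of_nat k, a + 1 - p, a + 1 - q,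
        a + 1 + of_nat N, s + of_nat n]"
      by (simp add: U_upper_def par fhs_defs)
    have lo: "U_lower N a b d e \<mu> n (b + of_nat k) = [a / 2, a + 1 + of_nat k, a + 1 - A - of_nat k, p, q,
        - of_nat N, a + 1 - (s + of_nat n), a + 1 - - of_nat n]"
      by (simp add: U_lower_def par fhs_defs)
    have e: "a + 1 - (a + 1 - x) = x" "a + 1 - (a + 1 + of_nat N) = - of_nat N" for x by simp_all
    show ?thesis
      unfolding U_par_def hyp_term_def up lo Ux_def c_def \<phi>_def vwp_def e list.map prod_list.Cons prod_list.Nil
        vwp_head[OF generic(2), symmetric] mpoch_def append.simps atLeast0AtMost pochhammer_fact
      by (intro sum.cong refl) (simp only: mult_1_right mult_1_left times_divide_times_eq mult_ac)
  qed
  have VV: "V_par N a b d e \<mu> m (b + of_nat k) = Vx m k" for k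
  proof -
    \<comment> \<open>The roles of \<open>p\<close> and \<open>q\<close> are interchanged relative
      to \<open>U\<close>: the entry \<open>- N - d + 1\<close> equals
      \<open>a' + 1 - q\<close>.\<close>
    have up: "V_upper N a b d e \<mu> m (b + of_nat k) = [a', 1 + a' / 2, - of_nat k, A + of_nat k, a' + 1 - q, a' + 1 - p,
        a' + 1 + of_nat N, s + of_nat m]"
      by (simp add: V_upper_def Let_def par fhs_defs)
    have lo: "V_lower N a b d e \<mu> m (b + of_nat k) = [a' / 2, a' + 1 + of_nat k, a' + 1 - A - of_nat k, q, p,
        - of_nat N, a' + 1 - (s + of_nat m), a' + 1 - - of_nat m]"
      by (simp add: V_lower_def Let_def par fhs_defs)
    have e: "a' + 1 - (a' + 1 - x) = x" "a' + 1 - (a' + 1 + of_nat N) = - of_nat N" for x by simp_all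
    show ?thesis
      unfolding V_par_def hyp_term_def up lo Vx_def vwp_def e list.map prod_list.Cons prod_list.Nil
        vwp_head[OF a', symmetric] mpoch_def append.simps atLeast0AtMost pochhammer_fact
      by (intro sum.cong refl) (simp only: mult_1_right mult_1_left times_divide_times_eq mult_ac)
  qed
  have r: "r_weight N a b d e \<mu> k = cst * w k" for k
  proof -
    have up: "[\<mu> + 2 * b, 1 + (\<mu> + 2 * b) / 2, \<mu> + 2 * b - a, a - d + 1, a - e + 1, - of_nat N,
           \<mu> + 2 * b + d + e - a + of_nat N - 1] = [A, 1 + A / 2, f, p, q, - of_nat N, h]"
      by (simp add: par fhs_defs)
    have lo: "r_lower N a b d e \<mu> = [A / 2, a + 1, A + 1 - p, A + 1 - q, A + 1 - - of_nat N, a' + 1, 1]"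
      by (simp add: r_lower_def par fhs_defs)
    have up': "[a + 1, \<mu> + 2 * b + d - a, \<mu> + 2 * b + e - a, d + e - a - 1]
        = [a + 1, A + 1 - p, A + 1 - q, a + 1 - p - q]"
      by (simp add: par)
    have lo': "r_const_lower a b d e \<mu> = [A + 1, a + 1 - p, a + 1 - q, A + 1 - p - q]"
      by (simp add: r_const_lower_def par)
    have e: "A + 1 - f = a + 1" "A + 1 - h = a' + 1"
      by (simp_all add: fhs_defs)
    show ?thesis
      unfolding r_weight_def up lo up' lo' w_def cst_def vwp_def e list.map prod_list.Cons prod_list.Nil
        vwp_head[OF generic(1), symmetric] mpoch_def pochhammer_fact
      by (simp only: mult_1_right mult_1_left times_divide_times_eq mult_ac)
  qed
  have "(\<Sum>k=0..N. U_par N a b d e \<mu> n (b + of_nat k) * V_par N a b d e \<mu> m (b + of_nat k)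
            * r_weight N a b d e \<mu> k) = cst * (\<Sum>k\<le>N. w k * Ux n k * Vx m k)"
    unfolding UU VV r sum_distrib_left atLeast0AtMost by (simp add: mult_ac)
  also have "\<dots> = (if n = m then cst * (lead n * (K n * D n 0 * G n n)) else 0)"
    using nm by (simp add: biorthogonal)
  also have "cst * (lead n * (K n * D n 0 * G n n)) = C_norm N a b d e \<mu> n"
  proof -
    have up: "[1, a + 1 - of_nat N - \<mu> - 2 * b - d, a + 1 - of_nat N - \<mu> - 2 * b - e]
        = [1, p - A - of_nat N, q - A - of_nat N]"
      by (simp add: par)
    have lo: "C_lower1 N a b d e \<mu> = [- of_nat N, - h, p]"
      by (simp add: C_lower1_def par fhs_defs)
    have up': "[2 * a + 2 - \<mu> - 2 * b - d - e, a + 2 - of_nat N - d - e, a + 1] = [p + q - A, a' + 1, a + 1]"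
      by (simp add: par fhs_defs)
    have lo': "C_lower2 N a b d e \<mu> = [q, a - A, s + 1]"
      by (simp add: C_lower2_def par fhs_defs)
    have s: "s_par N a b d e \<mu> = s"
      by (simp add: s_par_def par fhs_defs)
    have "s \<notin> \<int>" by (rule notint_shift(10)) (simp add: fhs_defs)
    then have "s \<noteq> 0" by auto
    \<comment> \<open>Since \<open>s\<close> is nonzero here, the quotient is 1 at
      \<open>n = 0\<close> anyway, and the case distinction in \<open>C_norm\<close>
      disappears.\<close>
    then have s': "(if n = 0 then 1 else (s + of_nat n) / (s + 2 * of_nat n)) = (s + of_nat n) / (s + 2 * of_nat n)"
      by simp
    show ?thesis
      unfolding cst_def norm_closed_form C_norm_def C_printed_def up lo up' lo' s s' mpoch_def
        list.map prod_list.Cons prod_list.Nil pochhammer_fact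
      by (simp only: mult_1_right mult_1_left mult_ac)
  qed
  finally show ?thesis by simp
qed

subsection \<open>Removing the genericity assumption\<close>

text \<open>At most one integer lies within distance 1/2 of \<open>x\<close>, and a nonconstant line
  meets it for only one value of \<open>t\<close>.\<close>

lemma eventually_line_not_Ints:
  fixes x c :: complex
  assumes "c \<noteq> 0"
  shows "eventually (\<lambda>t. x + c * t \<notin> \<int>) (at 0)"
proof -
  have lim: "((\<lambda>t. x + c * t) \<longlongrightarrow> x) (at 0)"
    by (auto intro!: tendsto_eq_intros)
  have near: "eventually (\<lambda>t. dist (x + c * t) x < 1 / 2) (at 0)"
    using tendstoD[OF lim, of "1 / 2"] by simp
  \<comment> \<open>If no integer is that close to \<open>x\<close>, the condition is vacuous and
    \<open>z\<close> is arbitrary.\<close>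
  obtain z where z: "\<And>y. y \<in> \<int> \<Longrightarrow> dist y x < 1 / 2 \<Longrightarrow> y = z"
  proof (cases "\<exists>z\<in>\<int>. dist z x < 1 / 2")
    case True
    then obtain z where z: "z \<in> \<int>" "dist z x < 1 / 2" by blast
    have "y = z" if y: "y \<in> \<int>" "dist y x < 1 / 2" for y
    proof -
      obtain i j where ij: "y = of_int i" "z = of_int j"
        using y z by (auto elim!: Ints_cases)
      have "dist y z < 1"
        using dist_triangle2[of y z x] y z by linarith
      then have "norm (of_int (i - j) :: complex) < 1"
        by (simp add: ij dist_norm)
      then have "\<bar>i - j\<bar> < 1"
        unfolding norm_of_int by linarith
      then show ?thesis by (simp add: ij)
    qed
    then show ?thesis using that by blast
  next
    case False
    then show ?thesis using that by blast
  qed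
  have "eventually (\<lambda>t. t \<noteq> (z - x) / c) (at 0)"
  proof (cases "(z - x) / c = 0")
    case True
    then show ?thesis by (auto simp: eventually_at_filter)
  next
    case False
    have "((\<lambda>t. t) \<longlongrightarrow> 0) (at (0::complex))" by (rule tendsto_ident_at)
    then show ?thesis using False by (intro tendsto_imp_eventually_ne) auto
  qed
  with near show ?thesis
  proof eventually_elim
    case (elim t)
    show ?case
    proof
      assume "x + c * t \<in> \<int>"
      with z[of "x + c * t"] elim have "x + c * t = z" by blast
      then have "t = (z - x) / c" using assms by (auto simp: field_simps)
      with elim show False by simp
    qed
  qed
qed

text \<open>The direction is chosen such that no linear form in \<open>generic_parameters\<close> is constant along the line.\<close>
lemma eventually_generic_parameters:
  fixes A a p q :: complex
  shows "eventually (\<lambda>t. generic_parameters (A + t) (a + 2 * t) (p + 10 * t) (q + 100 * t)) (at 0)"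
proof -
  have *: "eventually (\<lambda>t. y t \<notin> \<int>) (at 0)" if "c \<noteq> 0" "\<And>t. y t = x + c * t" for x c :: complex and y
    using eventually_line_not_Ints[OF that(1), of x] that(2) by simp
  show ?thesis
    unfolding generic_parameters_def
    apply (intro eventually_conj)
    apply (rule *[of 1 _ A], simp, simp)
    apply (rule *[of 2 _ a], simp, simp)
    apply (rule *[of 10 _ p], simp, simp)
    apply (rule *[of 100 _ q], simp, simp)
    apply (rule *[of "-1" _ "A - a"], simp, simp add: algebra_simps)
    apply (rule *[of "-9" _ "A - p"], simp, simp add: algebra_simps)
    apply (rule *[of "-99" _ "A - q"], simp, simp add: algebra_simps)
    apply (rule *[of "-8" _ "a - p"], simp, simp add: algebra_simps)
    apply (rule *[of "-98" _ "a - q"], simp, simp add: algebra_simps)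
    apply (rule *[of "109" _ "p + q - A"], simp, simp add: algebra_simps)
    apply (rule *[of "108" _ "p + q - a"], simp, simp add: algebra_simps)
    apply (rule *[of "-107" _ "A + a - p - q"], simp, simp add: algebra_simps)
    apply (rule *[of "117" _ "2 * p + q - A - a"], simp, simp add: algebra_simps)
    apply (rule *[of "207" _ "p + 2 * q - A - a"], simp, simp add: algebra_simps)
    apply (rule *[of "-11" _ "A - a - p"], simp, simp add: algebra_simps)
    apply (rule *[of "-101" _ "A - a - q"], simp, simp add: algebra_simps)
    done
qed

lemma isCont_pochhammer:
  fixes f :: "'a::t2_space \<Rightarrow> 'b::real_normed_field"
  assumes "isCont f x"
  shows "isCont (\<lambda>t. pochhammer (f t) k) x"
  unfolding pochhammer_prod by (intro continuous_intros assms)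

theorem corollary4p7:
  fixes N n m :: nat and a b d e \<mu> :: complex
  assumes "n \<le> N" and "m \<le> N"
    and "no_zero_denominators N a b d e \<mu> n m"
  shows "(\<Sum>k=0..N. U N a b d e \<mu> n (x_pt b \<mu> k) * V N a b d e \<mu> m (x_pt b \<mu> k)
            * r_weight N a b d e \<mu> k)
         = C_norm N a b d e \<mu> n * (if n = m then 1 else 0)"
proof -
  \<comment> \<open>The speeds of \<open>d\<close> and \<open>e\<close> are chosen so that
    \<open>a - d + 1\<close> moves by \<open>10 * t\<close> and \<open>a - e + 1\<close> by
    \<open>100 * t\<close>. As \<open>b\<close> stays fixed, \<open>\<mu> + 2 * b\<close> moves by
    \<open>t\<close>, as in \<open>eventually_generic_parameters\<close>.\<close>
  define aa where "aa = (\<lambda>t. a + 2 * t)"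
  define dd where "dd = (\<lambda>t. d - 8 * t)"
  define ee where "ee = (\<lambda>t. e - 98 * t)"
  define mm where "mm = (\<lambda>t. \<mu> + t)"
  note t_defs = aa_def dd_def ee_def mm_def
  have t0: "aa 0 = a" "dd 0 = d" "ee 0 = e" "mm 0 = \<mu>" by (simp_all add: t_defs)
  define F where "F = (\<lambda>t. (\<Sum>k=0..N. U_par N (aa t) b (dd t) (ee t) (mm t) n (b + of_nat k)
       * V_par N (aa t) b (dd t) (ee t) (mm t) m (b + of_nat k) * r_weight N (aa t) b (dd t) (ee t) (mm t) k)
       - C_norm N (aa t) b (dd t) (ee t) (mm t) n * (if n = m then 1 else 0))"
  have cont: "isCont aa 0" "isCont dd 0" "isCont ee 0" "isCont mm 0"
    unfolding t_defs by (intro continuous_intros)+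
  note mpoch_lists = mpoch_def append.simps list.map prod_list.Cons prod_list.Nil
  have nz: "\<And>k j. k \<le> N \<Longrightarrow> j \<le> n \<Longrightarrow> mpoch (U_lower N (aa 0) b (dd 0) (ee 0) (mm 0) n (b + of_nat k) @ [1]) j \<noteq> 0"
    "\<And>k j. k \<le> N \<Longrightarrow> j \<le> m \<Longrightarrow> mpoch (V_lower N (aa 0) b (dd 0) (ee 0) (mm 0) m (b + of_nat k) @ [1]) j \<noteq> 0"
    "\<And>k. k \<le> N \<Longrightarrow> mpoch (r_lower N (aa 0) b (dd 0) (ee 0) (mm 0)) k \<noteq> 0"
    "mpoch (r_const_lower (aa 0) b (dd 0) (ee 0) (mm 0)) N \<noteq> 0"
    "mpoch (C_lower1 N (aa 0) b (dd 0) (ee 0) (mm 0)) n \<noteq> 0"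
    "mpoch (C_lower2 N (aa 0) b (dd 0) (ee 0) (mm 0)) n \<noteq> 0"
    "n = m \<Longrightarrow> n \<noteq> 0 \<Longrightarrow> s_par N (aa 0) b (dd 0) (ee 0) (mm 0) + 2 * of_nat n \<noteq> 0"
    using assms(3) unfolding no_zero_denominators_def t0 by blast+
  have U: "isCont (\<lambda>t. U_par N (aa t) b (dd t) (ee t) (mm t) n (b + of_nat k)) 0" if "k \<le> N" for k
    unfolding U_par_def hyp_term_def
  proof (intro isCont_sum ballI isCont_divide)
    fix j assume "j \<in> {0..n}"
    then show "mpoch (U_lower N (aa 0) b (dd 0) (ee 0) (mm 0) n (b + of_nat k) @ [1]) j \<noteq> 0"
      using nz(1) that by simp
    show "isCont (\<lambda>t. mpoch (U_upper N (aa t) b (dd t) (ee t) (mm t) n (b + of_nat k) @ [- of_nat n]) j) 0"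
      unfolding U_upper_def mpoch_lists by (intro continuous_intros isCont_pochhammer cont; simp)
    show "isCont (\<lambda>t. mpoch (U_lower N (aa t) b (dd t) (ee t) (mm t) n (b + of_nat k) @ [1]) j) 0"
      unfolding U_lower_def mpoch_lists by (intro continuous_intros isCont_pochhammer cont; simp)
  qed
  have V: "isCont (\<lambda>t. V_par N (aa t) b (dd t) (ee t) (mm t) m (b + of_nat k)) 0" if "k \<le> N" for k
    unfolding V_par_def hyp_term_def
  proof (intro isCont_sum ballI isCont_divide)
    fix j assume "j \<in> {0..m}"
    then show "mpoch (V_lower N (aa 0) b (dd 0) (ee 0) (mm 0) m (b + of_nat k) @ [1]) j \<noteq> 0"
      using nz(2) that by simp
    show "isCont (\<lambda>t. mpoch (V_upper N (aa t) b (dd t) (ee t) (mm t) m (b + of_nat k) @ [- of_nat m]) j) 0"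
      unfolding V_upper_def Let_def mpoch_lists by (intro continuous_intros isCont_pochhammer cont; simp)
    show "isCont (\<lambda>t. mpoch (V_lower N (aa t) b (dd t) (ee t) (mm t) m (b + of_nat k) @ [1]) j) 0"
      unfolding V_lower_def Let_def mpoch_lists by (intro continuous_intros isCont_pochhammer cont; simp)
  qed
  have r: "isCont (\<lambda>t. r_weight N (aa t) b (dd t) (ee t) (mm t) k) 0" if "k \<le> N" for k
    unfolding r_weight_def
  proof (intro isCont_mult isCont_divide nz(3)[OF that] nz(4))
    show "isCont (\<lambda>t. mpoch [mm t + 2 * b, 1 + (mm t + 2 * b) / 2, mm t + 2 * b - aa t, aa t - dd t + 1,
        aa t - ee t + 1, - of_nat N, mm t + 2 * b + dd t + ee t - aa t + of_nat N - 1] k) 0"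
      unfolding mpoch_lists by (intro continuous_intros isCont_pochhammer cont; simp)
    show "isCont (\<lambda>t. mpoch (r_lower N (aa t) b (dd t) (ee t) (mm t)) k) 0"
      unfolding r_lower_def mpoch_lists by (intro continuous_intros isCont_pochhammer cont; simp)
    show "isCont (\<lambda>t. mpoch [aa t + 1, mm t + 2 * b + dd t - aa t, mm t + 2 * b + ee t - aa t,
        dd t + ee t - aa t - 1] N) 0"
      unfolding mpoch_lists by (intro continuous_intros isCont_pochhammer cont; simp)
    show "isCont (\<lambda>t. mpoch (r_const_lower (aa t) b (dd t) (ee t) (mm t)) N) 0"
      unfolding r_const_lower_def mpoch_lists by (intro continuous_intros isCont_pochhammer cont; simp)
  qed
  \<comment> \<open>For \<open>n \<noteq> m\<close> this function is constantly 0. For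
    \<open>n = m > 0\<close> the last clause of \<open>no_zero_denominators\<close> bounds
    \<open>s + 2n\<close> away from 0 near \<open>t = 0\<close>.\<close>
  have C: "isCont (\<lambda>t. C_norm N (aa t) b (dd t) (ee t) (mm t) n * (if n = m then 1 else 0)) 0"
  proof (cases "n = m")
    case True
    have "isCont (\<lambda>t. if n = 0 then 1 else (s_par N (aa t) b (dd t) (ee t) (mm t) + of_nat n)
        / (s_par N (aa t) b (dd t) (ee t) (mm t) + 2 * of_nat n)) 0"
    proof (cases "n = 0")
      case False
      have "isCont (\<lambda>t. s_par N (aa t) b (dd t) (ee t) (mm t)) 0"
        unfolding s_par_def by (intro continuous_intros cont)
      then show ?thesis
        using False nz(7)[OF True False] by (simp only: if_False) (intro continuous_intros, auto)
    qed simp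
    moreover have "isCont (\<lambda>t. C_printed N (aa t) b (dd t) (ee t) (mm t) n) 0"
      unfolding C_printed_def
    proof (intro isCont_mult isCont_divide nz(5,6))
      show "isCont (\<lambda>t. mpoch [1, aa t + 1 - of_nat N - mm t - 2 * b - dd t, aa t + 1 - of_nat N - mm t - 2 * b - ee t] n) 0"
        unfolding mpoch_lists by (intro continuous_intros isCont_pochhammer cont; simp)
      show "isCont (\<lambda>t. mpoch [2 * aa t + 2 - mm t - 2 * b - dd t - ee t, aa t + 2 - of_nat N - dd t - ee t, aa t + 1] n) 0"
        unfolding mpoch_lists by (intro continuous_intros isCont_pochhammer cont; simp)
      show "isCont (\<lambda>t. mpoch (C_lower1 N (aa t) b (dd t) (ee t) (mm t)) n) 0"
        unfolding C_lower1_def mpoch_lists by (intro continuous_intros isCont_pochhammer cont; simp)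
      show "isCont (\<lambda>t. mpoch (C_lower2 N (aa t) b (dd t) (ee t) (mm t)) n) 0"
        unfolding C_lower2_def mpoch_lists by (intro continuous_intros isCont_pochhammer cont; simp)
    qed
    ultimately show ?thesis
      unfolding C_norm_def using True by (simp only: if_True) (intro continuous_intros)
  qed simp
  have "isCont F 0"
    unfolding F_def by (rule isCont_diff[OF _ C]) (intro isCont_sum ballI isCont_mult U V r; simp)
  then have "F \<midarrow>0\<rightarrow> F 0"
    by (rule isContD)
  \<comment> \<open>The generic identity gives \<open>F t = 0\<close> for all small
    \<open>t \<noteq> 0\<close>; continuity then forces \<open>F 0 = 0\<close>, the claim at the
    given parameters.\<close>
  moreover have "eventually (\<lambda>t. F t = 0) (at 0)"
    using eventually_generic_parameters[of "\<mu> + 2 * b" a "a - d + 1" "a - e + 1"]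
  proof eventually_elim
    case (elim t)
    have e: "mm t + 2 * b = \<mu> + 2 * b + t" "aa t - dd t + 1 = a - d + 1 + 10 * t"
      "aa t - ee t + 1 = a - e + 1 + 100 * t"
      by (simp_all add: t_defs)
    have e': "aa t = a + 2 * t"
      by (simp add: aa_def)
    have "generic_parameters (mm t + 2 * b) (aa t) (aa t - dd t + 1) (aa t - ee t + 1)"
      unfolding e unfolding e' by (fact elim)
    from corollary4p7_generic[OF assms(1,2) this] show ?case
      by (simp only: F_def right_minus_eq)
  qed
  then have "F \<midarrow>0\<rightarrow> 0"
    by (rule tendsto_eventually)
  ultimately have "F 0 = 0"
    by (rule LIM_unique)
  then show ?thesis
    by (simp only: F_def t0 right_minus_eq x_pt_def U_eq V_eq)
qed

end
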